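(* Let $K$ be a field, $n\ge 1$, $S=K[x_1,\ldots,x_n]$, and let $I\subset S$ be a monomial ideal such that all powers $I^k$, $k\ge 1$, have a linear resolution. Then there exists a quasi-linear function $f:\mathbb{Z}\to\mathbb{Z}$ such that $f(k)=\mathrm{sat}(I^k)$ for all $k\gg 0$.
   Context: $S=K[x_1,\ldots,x_n]$ is standard graded with graded maximal ideal $\mathfrak{m}=(x_1,\ldots,x_n)$. For a graded ideal $J\subset S$, the saturation number $\mathrm{sat}(J)$ is the smallest integer $k\ge 0$ such that $J:\mathfrak{m}^{k+1}=J:\mathfrak{m}^k$. A function $f:\mathbb{Z}\to\mathbb{Z}$ is called quasi-linear if there exist an integer $d\ge 1$ and, for $i=0,\ldots,d-1$, linear functions $f_i(x)=a_ix+b_i$ with $a_i,b_i\in\mathbb{Q}$ such that $f(k)=f_i(k)$ whenever $k\equiv i \bmod d$. A graded ideal has a linear resolution if it is generated in a single degree $e$ and its minimal graded free resolution is $e$-linear, i.e. its $i$-th syzygy module is generated in degree $e+i$ for all $i$. *)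

theory Defs
  imports Complex_Main "HOL-Library.Poly_Mapping" "HOL-Number_Theory.Cong"
begin

section \<open>The polynomial ring and its ideals\<close>

text \<open>
  \<open>('n, 'k) mpoly\<close> is the polynomial ring over \<open>'k\<close> in the variables indexed by \<open>'n\<close>: a polynomial
  is a finitely supported map from exponent vectors to coefficients, with the convolution product.
  For \<open>'n :: finite\<close> it is \<open>K[x\<^sub>1,\<dots>,x\<^sub>n]\<close> with \<open>n = CARD('n) \<ge> 1\<close>.
\<close>

type_synonym ('n, 'k) mpoly = "('n \<Rightarrow>\<^sub>0 nat) \<Rightarrow>\<^sub>0 'k"

definition monomial :: "('n \<Rightarrow>\<^sub>0 nat) \<Rightarrow> ('n, 'k::field) mpoly" where
  "monomial m = Poly_Mapping.single m 1"

definition var :: "'n \<Rightarrow> ('n, 'k::field) mpoly" where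
  "var i = monomial (Poly_Mapping.single i 1)"

definition mdegree :: "('n::finite \<Rightarrow>\<^sub>0 nat) \<Rightarrow> nat" where
  "mdegree m = (\<Sum>i\<in>UNIV. Poly_Mapping.lookup m i)"

text \<open>The zero polynomial is homogeneous of every degree, and the only one of negative degree.\<close>

definition homogeneous :: "int \<Rightarrow> ('n::finite, 'k::field) mpoly \<Rightarrow> bool" where
  "homogeneous d f \<longleftrightarrow> (\<forall>m\<in>Poly_Mapping.keys f. int (mdegree m) = d)"

text \<open>
  Ideals are the submodules of the ring. There is no global interpretation because its simp rule
  \<open>a * (b * x) = (a * b) * x\<close> would loop with \<open>mult.assoc\<close>.
\<close>

lemma module_mult: "module ((*) :: 'a::comm_ring_1 \<Rightarrow> 'a \<Rightarrow> 'a)"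
  by standard (simp_all add: algebra_simps)

definition ideal_generated :: "'a::comm_ring_1 set \<Rightarrow> 'a set" where
  "ideal_generated = module.span (*)"

definition monomial_ideal :: "('n, 'k::field) mpoly set \<Rightarrow> bool" where
  "monomial_ideal I \<longleftrightarrow> (\<exists>A. I = ideal_generated (monomial ` A))"

definition ideal_mult :: "'a::comm_ring_1 set \<Rightarrow> 'a set \<Rightarrow> 'a set" where
  "ideal_mult I J = ideal_generated {f * g | f g. f \<in> I \<and> g \<in> J}"

primrec ideal_power :: "'a::comm_ring_1 set \<Rightarrow> nat \<Rightarrow> 'a set" where
  "ideal_power I 0 = UNIV"
| "ideal_power I (Suc k) = ideal_mult I (ideal_power I k)"

definition ideal_colon :: "'a::comm_ring_1 set \<Rightarrow> 'a set \<Rightarrow> 'a set" where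
  "ideal_colon J L = {f. \<forall>g\<in>L. f * g \<in> J}"

definition graded_max_ideal :: "('n, 'k::field) mpoly set" where
  "graded_max_ideal = ideal_generated (range var)"

definition sat :: "('n, 'k::field) mpoly set \<Rightarrow> nat" where
  "sat J = (LEAST k. ideal_colon J (ideal_power graded_max_ideal (k + 1))
                   = ideal_colon J (ideal_power graded_max_ideal k))"


section \<open>Graded free modules of finite rank\<close>

type_synonym ('n, 'k) mvec = "nat \<Rightarrow>\<^sub>0 ('n, 'k) mpoly"

definition vec_scale :: "'a::comm_ring_1 \<Rightarrow> (nat \<Rightarrow>\<^sub>0 'a) \<Rightarrow> (nat \<Rightarrow>\<^sub>0 'a)" where
  "vec_scale c v = Poly_Mapping.map ((*) c) v"

lemma lookup_vec_scale [simp]: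
  "Poly_Mapping.lookup (vec_scale c v) j = c * Poly_Mapping.lookup v j"
  by (simp add: vec_scale_def Poly_Mapping.map.rep_eq when_def)

global_interpretation vec_module: module "vec_scale :: 'a::comm_ring_1 \<Rightarrow> (nat \<Rightarrow>\<^sub>0 'a) \<Rightarrow> (nat \<Rightarrow>\<^sub>0 'a)"
  defines vec_span = vec_module.span
  by standard (rule poly_mapping_eqI, simp add: lookup_add algebra_simps)+

definition free_module :: "nat \<Rightarrow> (nat \<Rightarrow>\<^sub>0 'a::comm_ring_1) set" where
  "free_module r = {v. Poly_Mapping.keys v \<subseteq> {..<r}}"

text \<open>Homogeneity in \<open>\<Oplus>\<^sub>j S(-deg j)\<close>, where the \<open>j\<close>-th basis element has degree \<open>deg j\<close>.\<close>

definition vec_homogeneous :: "(nat \<Rightarrow> int) \<Rightarrow> int \<Rightarrow> ('n::finite, 'k::field) mvec \<Rightarrow> bool" where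
  "vec_homogeneous deg d v \<longleftrightarrow> (\<forall>j. homogeneous (d - deg j) (Poly_Mapping.lookup v j))"

definition ideal_generated_in_degree :: "int \<Rightarrow> ('n::finite, 'k::field) mpoly set \<Rightarrow> bool" where
  "ideal_generated_in_degree d I \<longleftrightarrow> I = ideal_generated {f \<in> I. homogeneous d f}"

definition submodule_generated_in_degree ::
    "(nat \<Rightarrow> int) \<Rightarrow> int \<Rightarrow> ('n::finite, 'k::field) mvec set \<Rightarrow> bool" where
  "submodule_generated_in_degree deg d M \<longleftrightarrow> M = vec_span {v \<in> M. vec_homogeneous deg d v}"


section \<open>Minimal graded free resolutions\<close>

text \<open>
  A resolution \<open>\<cdots> \<rightarrow> F\<^sub>2 \<rightarrow> F\<^sub>1 \<rightarrow> F\<^sub>0 \<rightarrow> I \<rightarrow> 0\<close> with \<open>F\<^sub>i = \<Oplus>\<^sub>j S(-deg i j)\<close>, \<open>j < rk i\<close>, augmentation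
  \<open>\<epsilon> : F\<^sub>0 \<rightarrow> I\<close> and differentials \<open>\<delta> i : F\<^sub>i\<^sub>+\<^sub>1 \<rightarrow> F\<^sub>i\<close>. The maps are given as linear maps on the whole
  type of vectors; only their restrictions to the \<open>F\<^sub>i\<close> matter, and every linear map on \<open>F\<^sub>i\<close> extends
  (by zero on the remaining basis vectors).
\<close>

locale graded_free_resolution =
  fixes I :: "('n::finite, 'k::field) mpoly set"
    and rk :: "nat \<Rightarrow> nat"
    and deg :: "nat \<Rightarrow> nat \<Rightarrow> int"
    and \<epsilon> :: "('n, 'k) mvec \<Rightarrow> ('n, 'k) mpoly"
    and \<delta> :: "nat \<Rightarrow> ('n, 'k) mvec \<Rightarrow> ('n, 'k) mvec"
  assumes linear_augmentation: "module_hom vec_scale (*) \<epsilon>"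
    and linear_differential: "module_hom vec_scale vec_scale (\<delta> i)"
    and graded_augmentation:
      "\<lbrakk>v \<in> free_module (rk 0); vec_homogeneous (deg 0) d v\<rbrakk> \<Longrightarrow> homogeneous d (\<epsilon> v)"
    and graded_differential:
      "\<lbrakk>v \<in> free_module (rk (Suc i)); vec_homogeneous (deg (Suc i)) d v\<rbrakk>
        \<Longrightarrow> vec_homogeneous (deg i) d (\<delta> i v)"
    and exact_ideal: "\<epsilon> ` free_module (rk 0) = I"
    and exact_0: "\<delta> 0 ` free_module (rk 1) = {v \<in> free_module (rk 0). \<epsilon> v = 0}"
    and exact_Suc:
      "\<delta> (Suc i) ` free_module (rk (Suc (Suc i))) = {v \<in> free_module (rk (Suc i)). \<delta> i v = 0}"

locale minimal_graded_free_resolution = graded_free_resolution +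
  assumes minimal:
    "v \<in> free_module (rk (Suc i)) \<Longrightarrow> Poly_Mapping.lookup (\<delta> i v) j \<in> graded_max_ideal"

text \<open>
  The syzygy module of index \<open>0\<close> is \<open>I\<close> itself, the one of index \<open>i + 1\<close> is the image of \<open>\<delta> i\<close> in \<open>F\<^sub>i\<close>.
  Minimal graded free resolutions exist and are unique up to isomorphism, so the existential
  quantifier speaks about \<^emph>\<open>the\<close> minimal resolution. The zero module counts as generated in every
  degree; in particular the zero ideal has a linear resolution.
\<close>

definition linear_resolution :: "nat \<Rightarrow> ('n::finite, 'k::field) mpoly set \<Rightarrow> bool" where
  "linear_resolution e I \<longleftrightarrow>
     ideal_generated_in_degree (int e) I \<and>
     (\<exists>rk deg \<epsilon> \<delta>. minimal_graded_free_resolution I rk deg \<epsilon> \<delta> \<and>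
        (\<forall>i. submodule_generated_in_degree (deg i) (int (e + (i + 1)))
               (\<delta> i ` free_module (rk (Suc i)))))"

definition has_linear_resolution :: "('n::finite, 'k::field) mpoly set \<Rightarrow> bool" where
  "has_linear_resolution I \<longleftrightarrow> (\<exists>e. linear_resolution e I)"


section \<open>Quasi-linear functions\<close>

definition quasi_linear :: "(int \<Rightarrow> int) \<Rightarrow> bool" where
  "quasi_linear f \<longleftrightarrow>
     (\<exists>d::nat. d \<ge> 1 \<and> (\<exists>a b :: nat \<Rightarrow> rat. \<forall>i<d. \<forall>k::int.
        [k = int i] (mod int d) \<longrightarrow> of_int (f k) = a i * of_int k + b i))"

end

theory Submission
  imports Defs
begin

text \<open>
  Let \<open>J\<close> be a nonzero ideal with linear resolution, generated in degree \<open>e\<close>. A diagram chase between the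
  Koszul complex and the resolution shows that the socle of \<open>S/J\<close> vanishes in degrees \<open>\<ge> e\<close>, so \<open>J\<close> and
  its saturation agree there, and \<open>sat(J) = e - s\<close>, where \<open>s\<close> is the least degree of an element of the
  saturation. If \<open>I\<close> is generated in degree \<open>D\<close>, then \<open>J = I\<^sup>k\<close> has \<open>e = kD\<close>, and the least degrees \<open>s\<^sub>k\<close>
  of the saturations satisfy \<open>s\<^sub>k\<^sub>+\<^sub>l \<le> s\<^sub>k + s\<^sub>l\<close>. The exponents of the saturations of all
  powers form the projection of the lattice points of a rational cone, so by Dickson's lemma the
  infimum of \<open>s\<^sub>k / k\<close> is attained, say \<open>a / d\<close> at \<open>k = d\<close> with \<open>a = s\<^sub>d\<close>. Hence \<open>d s\<^sub>k - a k\<close> is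
  nonnegative and nonincreasing along \<open>k \<mapsto> k + d\<close>, and so eventually constant on each residue class
  modulo \<open>d\<close>.
\<close>

section \<open>Koszul cochains\<close>

text \<open>Why \<open>e\<close> is the threshold: the socle of \<open>S/J\<close> is the top Koszul
  homology of \<open>S/J\<close>, that is \<open>Tor_n(S/J, K)\<close> with degrees shifted by
  \<open>n\<close>. This Tor embeds into \<open>Tor_(n-1)(J, K)\<close>, which by linearity sits in
  degree \<open>e + n - 1\<close>, so the socle sits in degree \<open>e - 1\<close>. The comparison
  of the two ways to compute Tor is done on explicit cochains, with lower bounds on degrees only, so
  that neither the socle element nor its lifts have to be homogeneous. The obstacle in the second
  half: the pairs of an exponent in the saturation of the \<open>k\<close>-th power and
  \<open>k\<close> itself form a monoid that need not be closed under differences of comparable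
  elements, while the argument from Dickson's lemma subtracts. Extra coordinates repair this: the
  multiplicities of the generators that prove membership, and the slacks of the inequalities between
  them and the exponent. The slope \<open>D - a / d\<close> is common to all residue classes; only
  the constant terms vary.\<close>

text \<open>
  A cochain is a function on the finite sets of indices, and \<open>kd X r\<close> is the Koszul differential of
  the first \<open>r\<close> of the commuting operators \<open>X\<close>. Only its values at subsets of \<open>{..<r}\<close> are meaningful.
  The recursion is the mapping cone of the last operator, which avoids explicit signs.
\<close>

fun kd :: "(nat \<Rightarrow> 'v \<Rightarrow> 'v) \<Rightarrow> nat \<Rightarrow> (nat set \<Rightarrow> 'v::ab_group_add) \<Rightarrow> nat set \<Rightarrow> 'v" where
  "kd X 0 g A = 0"
| "kd X (Suc r) g A =
     (if r \<in> A then X r (g (A - {r})) - kd X r (\<lambda>B. g (insert r B)) (A - {r}) else kd X r g A)"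

lemma kd_Suc_in [simp]:
  "r \<in> A \<Longrightarrow> kd X (Suc r) g A = X r (g (A - {r})) - kd X r (\<lambda>B. g (insert r B)) (A - {r})"
  by simp

lemma kd_Suc_notin [simp]: "r \<notin> A \<Longrightarrow> kd X (Suc r) g A = kd X r g A"
  by simp

declare kd.simps(2) [simp del]

lemma subset_lessThan_Suc_Diff: "A \<subseteq> {..<Suc r} \<Longrightarrow> A - {r} \<subseteq> {..<r}"
  by (auto simp: less_Suc_eq)

lemma subset_lessThan_Suc_notin: "A \<subseteq> {..<Suc r} \<Longrightarrow> r \<notin> A \<Longrightarrow> A \<subseteq> {..<r}"
  by (auto simp: less_Suc_eq)

text \<open>This locality is what allows a cochain to be prescribed in one cardinality only, and its
  value at the full index set to be changed freely.\<close>

lemma kd_cong: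
  assumes "A \<subseteq> {..<r}" "\<And>i. i \<in> A \<Longrightarrow> g (A - {i}) = g' (A - {i})"
  shows "kd X r g A = kd X r g' A"
  using assms
proof (induction r arbitrary: A g g')
  case (Suc r)
  show ?case
  proof (cases "r \<in> A")
    case True
    have "kd X r (\<lambda>B. g (insert r B)) (A - {r}) = kd X r (\<lambda>B. g' (insert r B)) (A - {r})"
    proof (rule Suc.IH)
      fix i assume i: "i \<in> A - {r}"
      then have "insert r (A - {r} - {i}) = A - {i}" using True by auto
      then show "g (insert r (A - {r} - {i})) = g' (insert r (A - {r} - {i}))"
        using Suc.prems(2) i by simp
    qed (use Suc.prems in \<open>auto simp: less_Suc_eq\<close>)
    then show ?thesis using True Suc.prems by simp
  next
    case False
    then show ?thesis
      using Suc.IH[of A g g'] Suc.prems subset_lessThan_Suc_notin by simp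
  qed
qed simp

lemma kd_hom:
  assumes "\<And>u v. \<Phi> (u - v) = \<Phi> u - \<Phi> v" "\<And>i v. \<Phi> (X i v) = Y i (\<Phi> v)"
  shows "\<Phi> (kd X r g A) = kd Y r (\<lambda>B. \<Phi> (g B)) A"
proof (induction r arbitrary: A g)
  case 0
  have "\<Phi> (0 - 0) = \<Phi> 0 - \<Phi> 0" by (rule assms)
  then show ?case by simp
qed (simp add: assms kd.simps(2))

lemma kd_zero:
  assumes "\<And>i. X i 0 = 0"
  shows "kd X r (\<lambda>B. 0) A = 0"
  by (induction r arbitrary: A) (simp_all add: assms kd.simps(2))

lemma kd_empty: "kd X r g {} = 0"
  by (induction r) simp_all

lemma kd_singleton: "i < r \<Longrightarrow> kd X r g {i} = X i (g {})"
  by (induction r arbitrary: g) (auto simp: kd_empty less_Suc_eq)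

lemma kd_diff:
  assumes "\<And>i u v. X i (u - v) = X i u - X i v"
  shows "kd X r (\<lambda>B. g B - g' B) A = kd X r g A - kd X r g' A"
  by (induction r arbitrary: A g g') (simp_all add: assms kd.simps(2))

text \<open>At a set containing the last index, \<open>X r\<close> applied to the differential of
  the part avoiding \<open>r\<close> occurs twice with opposite signs, because \<open>X r\<close>
  commutes with the earlier operators. The rest vanishes by induction.\<close>

lemma kd_kd:
  assumes X: "\<And>i u v. X i (u - v) = X i u - X i v" "\<And>i j v. X i (X j v) = X j (X i v)"
  assumes "A \<subseteq> {..<r}"
  shows "kd X r (kd X r g) A = 0"
  using assms(3)
proof (induction r arbitrary: A g)
  case (Suc r)
  show ?case
  proof (cases "r \<in> A")
    case True
    let ?A = "A - {r}" and ?g = "\<lambda>B. g (insert r B)"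
    have A: "?A \<subseteq> {..<r}" using Suc.prems by (rule subset_lessThan_Suc_Diff)
    have "kd X r (\<lambda>B. kd X (Suc r) g (insert r B)) ?A = kd X r (\<lambda>B. X r (g B) - kd X r ?g B) ?A"
      by (rule kd_cong[OF A]) (simp add: insert_Diff_if)
    also have "\<dots> = kd X r (\<lambda>B. X r (g B)) ?A"
      using kd_diff[of X r "\<lambda>B. X r (g B)" "kd X r ?g" ?A, OF X(1)] Suc.IH[OF A] by simp
    also have "\<dots> = X r (kd X r g ?A)"
      by (rule kd_hom[of "X r" X X r g ?A, OF X(1) X(2), symmetric])
    finally have "kd X r (\<lambda>B. kd X (Suc r) g (insert r B)) ?A = X r (kd X (Suc r) g ?A)"
      by simp
    then show ?thesis using True by simp
  next
    case False
    then have A: "A \<subseteq> {..<r}" using Suc.prems by (auto simp: less_Suc_eq)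
    have "kd X r (kd X (Suc r) g) A = kd X r (kd X r g) A"
      by (rule kd_cong[OF A]) (use False in simp)
    then show ?thesis using False Suc.IH[OF A] by simp
  qed
qed simp

text \<open>
  The operators \<open>Q i\<close> extract a quotient by \<open>X i\<close>. They witness that the \<open>X i\<close> form a regular sequence:
  if \<open>X r a = (\<Sum>i<r. X i (c i))\<close>, then \<open>a = (\<Sum>i<r. X i (Q r (c i)))\<close>.
\<close>

locale koszul =
  fixes X Q :: "nat \<Rightarrow> 'v::ab_group_add \<Rightarrow> 'v" and n :: nat and F :: "'v set"
  assumes X_diff: "X i (u - v) = X i u - X i v"
    and X_comm: "X i (X j v) = X j (X i v)"
    and Q_diff: "Q i (u - v) = Q i u - Q i v"
    and Q_X_same: "Q i (X i v) = v"
    and Q_X: "i < n \<Longrightarrow> j < n \<Longrightarrow> i \<noteq> j \<Longrightarrow> Q i (X j v) = X j (Q i v)"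
    and F_0: "0 \<in> F"
    and F_diff: "u \<in> F \<Longrightarrow> v \<in> F \<Longrightarrow> u - v \<in> F"
    and F_X: "v \<in> F \<Longrightarrow> X i v \<in> F"
    and F_Q: "v \<in> F \<Longrightarrow> Q i v \<in> F"
begin

lemma X_0 [simp]: "X i 0 = 0"
  using X_diff[of i 0 0] by simp

lemma X_minus: "X i (- v) = - X i v"
  using X_diff[of i 0 v] by simp

lemma Q_0 [simp]: "Q i 0 = 0"
  using Q_diff[of i 0 0] by simp

lemma Q_add: "Q i (u + v) = Q i u + Q i v"
  using Q_diff[of i u "- v"] Q_diff[of i 0 v] by simp

lemma Q_sum: "Q i (sum c A) = (\<Sum>j\<in>A. Q i (c j))"
  by (induction A rule: infinite_finite_induct) (simp_all add: Q_add)

lemma F_minus: "v \<in> F \<Longrightarrow> - v \<in> F"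
  using F_diff[of 0 v] F_0 by simp

text \<open>The quotient of \<open>F\<close> by this submodule is the top cohomology of the Koszul
  complex of the first \<open>r\<close> operators.\<close>

definition ispan :: "nat \<Rightarrow> 'v set" where
  "ispan r = {\<Sum>i<r. X i (c i) | c. range c \<subseteq> F}"

lemma ispanI: "range c \<subseteq> F \<Longrightarrow> (\<Sum>i<r. X i (c i)) \<in> ispan r"
  unfolding ispan_def by blast

lemma ispanE:
  assumes "v \<in> ispan r"
  obtains c where "range c \<subseteq> F" "v = (\<Sum>i<r. X i (c i))"
  using assms unfolding ispan_def by blast

lemma ispan_Suc: "v \<in> ispan (Suc r) \<longleftrightarrow> (\<exists>u\<in>ispan r. \<exists>w\<in>F. v = u + X r w)"
proof
  assume "v \<in> ispan (Suc r)"
  then obtain c where c: "range c \<subseteq> F" "v = (\<Sum>i<Suc r. X i (c i))"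
    by (rule ispanE)
  show "\<exists>u\<in>ispan r. \<exists>w\<in>F. v = u + X r w"
  proof (intro bexI)
    show "v = (\<Sum>i<r. X i (c i)) + X r (c r)" using c by simp
  qed (use c in \<open>auto intro: ispanI\<close>)
next
  assume "\<exists>u\<in>ispan r. \<exists>w\<in>F. v = u + X r w"
  then obtain u w where uw: "u \<in> ispan r" "w \<in> F" "v = u + X r w" by blast
  then obtain c where c: "range c \<subseteq> F" "u = (\<Sum>i<r. X i (c i))" by (elim ispanE)
  have "v = (\<Sum>i<Suc r. X i ((c(r := w)) i))" using c uw by simp
  moreover have "range (c(r := w)) \<subseteq> F" using c uw by auto
  ultimately show "v \<in> ispan (Suc r)" using ispanI by metis
qed

lemma ispan_0: "0 \<in> ispan r"
  using ispanI[of "\<lambda>_. 0" r] F_0 by auto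

lemma ispan_minus: "v \<in> ispan r \<Longrightarrow> - v \<in> ispan r"
proof -
  assume "v \<in> ispan r"
  then obtain c where c: "range c \<subseteq> F" "v = (\<Sum>i<r. X i (c i))" by (rule ispanE)
  then have "- v = (\<Sum>i<r. X i (- c i))" by (simp add: X_minus sum_negf)
  moreover have "range (\<lambda>i. - c i) \<subseteq> F" using c F_minus by auto
  ultimately show ?thesis using ispanI by metis
qed

lemma ispan_regular:
  assumes "X r v \<in> ispan r" "r < n"
  shows "v \<in> ispan r"
proof -
  obtain c where c: "range c \<subseteq> F" "X r v = (\<Sum>i<r. X i (c i))" using assms(1) by (rule ispanE)
  have "v = Q r (X r v)" by (simp add: Q_X_same)
  also have "\<dots> = (\<Sum>i<r. X i (Q r (c i)))" unfolding c Q_sum using assms by (auto intro!: sum.cong Q_X)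
  also have "\<dots> \<in> ispan r" using c F_Q by (intro ispanI) auto
  finally show ?thesis .
qed

lemma kd_in_ispan: "(\<And>B. g B \<in> F) \<Longrightarrow> kd X r g A \<in> ispan r"
proof (induction r arbitrary: g A)
  case 0
  show ?case using ispan_0[of 0] by simp
next
  case (Suc r)
  show ?case
  proof (cases "r \<in> A")
    case True
    have "- kd X r (\<lambda>B. g (insert r B)) (A - {r}) \<in> ispan r"
      by (intro ispan_minus Suc)
    then show ?thesis
      unfolding ispan_Suc using True Suc.prems[of "A - {r}"]
      by (intro bexI[of _ "- kd X r (\<lambda>B. g (insert r B)) (A - {r})"] bexI[of _ "g (A - {r})"]) simp_all
  next
    case False
    then show ?thesis unfolding ispan_Suc using Suc.IH[OF Suc.prems] F_0
      by (intro bexI[of _ "kd X r g A"] bexI[of _ 0]) simp_all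
  qed
qed

lemma kd_in: "(\<And>B. g B \<in> F) \<Longrightarrow> kd X r g A \<in> F"
  by (induction r arbitrary: g A) (auto simp: F_0 F_diff F_X kd.simps(2))

text \<open>All cardinalities are treated at once; the top value is the only obstruction. In the
  cone over the last operator, the part of \<open>g\<close> avoiding \<open>r\<close> is a cocycle
  whose top value becomes a coboundary after multiplication by \<open>X r\<close>, so regularity
  removes its obstruction and induction gives a primitive. The part containing \<open>r\<close> then
  differs from \<open>X r\<close> of that primitive by another cocycle, to which induction applies
  again.\<close>

lemma koszul_exact:
  assumes "r \<le> n" "\<And>A. g A \<in> F" "\<And>A. A \<subseteq> {..<r} \<Longrightarrow> kd X r g A = 0" "g {..<r} \<in> ispan r"
  shows "\<exists>h. (\<forall>A. h A \<in> F) \<and> (\<forall>A\<subseteq>{..<r}. kd X r h A = g A)"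
  using assms
proof (induction r arbitrary: g)
  case 0
  then have "g {} = 0" by (simp add: ispan_def)
  then show ?case using F_0 by (auto intro!: exI[of _ "\<lambda>_. 0"])
next
  case (Suc r)
  let ?b = "\<lambda>B. g (insert r B)"
  have ga: "kd X r g A = 0" if "A \<subseteq> {..<r}" for A
  proof -
    have "r \<notin> A" "A \<subseteq> {..<Suc r}" using that by auto
    then show ?thesis using Suc.prems(3)[of A] by simp
  qed
  have gb: "X r (g A) = kd X r ?b A" if "A \<subseteq> {..<r}" for A
  proof -
    have "r \<notin> A" "insert r A \<subseteq> {..<Suc r}" using that by auto
    then show ?thesis using Suc.prems(3)[of "insert r A"] by simp
  qed
  have "X r (g {..<r}) \<in> ispan r"
    unfolding gb[OF order_refl] using Suc.prems(2) by (intro kd_in_ispan)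
  then have "g {..<r} \<in> ispan r" using ispan_regular Suc.prems(1) by simp
  then obtain h where h: "\<And>A. h A \<in> F" "\<And>A. A \<subseteq> {..<r} \<Longrightarrow> kd X r h A = g A"
    using Suc.IH[of g, OF _ Suc.prems(2) ga] Suc.prems(1) by force
  have "g {..<Suc r} \<in> ispan (Suc r)" by (rule Suc.prems)
  then obtain u w where uw: "u \<in> ispan r" "w \<in> F" "g {..<Suc r} = u + X r w"
    unfolding ispan_Suc by blast
  \<comment> \<open>The value of \<open>h\<close> at \<open>{..<r}\<close> does not enter its
    coboundary on subsets of \<open>{..<r}\<close>. Choosing \<open>w\<close> there cancels the
    \<open>X r\<close> part of \<open>g {..<Suc r}\<close> and leaves \<open>- u\<close>, which lies
    in \<open>ispan r\<close>, as the top value of \<open>g2\<close>.\<close>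
  define h1 where "h1 = h({..<r} := w)"
  have h1: "h1 A \<in> F" for A using h uw by (simp add: h1_def)
  have kdh1: "kd X r h1 A = g A" if "A \<subseteq> {..<r}" for A
  proof -
    have "kd X r h1 A = kd X r h A"
      by (rule kd_cong[OF that]) (use that in \<open>auto simp: h1_def\<close>)
    then show ?thesis using h that by simp
  qed
  \<comment> \<open>The cone formula dictates \<open>g2\<close>: it is what the differential of the
    part of the primitive containing \<open>r\<close> has to be.\<close>
  define g2 where "g2 = (\<lambda>A. X r (h1 A) - ?b A)"
  have g2F: "g2 A \<in> F" for A unfolding g2_def using h1 Suc.prems(2) by (intro F_diff F_X)
  have kdg2: "kd X r g2 A = 0" if "A \<subseteq> {..<r}" for A
    unfolding g2_def kd_diff[of X, OF X_diff]
    using kd_hom[of "X r" X X r h1 A, OF X_diff X_comm, symmetric] kdh1[OF that] gb[OF that] by simp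
  have "g2 {..<r} = - u"
    using uw by (simp add: g2_def h1_def lessThan_Suc)
  then have "g2 {..<r} \<in> ispan r" using uw ispan_minus by simp
  then obtain h' where h': "\<And>A. h' A \<in> F" "\<And>A. A \<subseteq> {..<r} \<Longrightarrow> kd X r h' A = g2 A"
    using Suc.IH[of g2, OF _ g2F kdg2] Suc.prems(1) by force
  define H where "H = (\<lambda>A. if r \<in> A then h' (A - {r}) else h1 A)"
  have "kd X (Suc r) H A = g A" if A: "A \<subseteq> {..<Suc r}" for A
  proof (cases "r \<in> A")
    case True
    have A': "A - {r} \<subseteq> {..<r}" using A by (rule subset_lessThan_Suc_Diff)
    have "kd X r (\<lambda>B. H (insert r B)) (A - {r}) = kd X r h' (A - {r})"
      by (rule kd_cong[OF A']) (simp add: H_def)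
    also have "\<dots> = X r (h1 (A - {r})) - g A"
      using h' A' True by (simp add: g2_def insert_absorb)
    finally show ?thesis using True by (simp add: H_def)
  next
    case False
    have A': "A \<subseteq> {..<r}" using A False by (rule subset_lessThan_Suc_notin)
    have "kd X r H A = kd X r h1 A"
      by (rule kd_cong[OF A']) (use False in \<open>simp add: H_def\<close>)
    then show ?thesis using False kdh1[OF A'] by simp
  qed
  moreover have "H A \<in> F" for A using h1 h' by (simp add: H_def)
  ultimately show ?case by blast
qed

end

section \<open>Monomial ideals\<close>

abbreviation "lookup \<equiv> Poly_Mapping.lookup"
abbreviation "keys \<equiv> Poly_Mapping.keys"

definition upclosed :: "'a::comm_monoid_add set \<Rightarrow> bool" where
  "upclosed E \<longleftrightarrow> (\<forall>m\<in>E. \<forall>v. m + v \<in> E)"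

text \<open>An ideal when \<open>E\<close> is upward closed. Powers, colons and saturations then
  become operations on exponent sets, in which the field no longer occurs.\<close>

definition mon_ideal :: "('n \<Rightarrow>\<^sub>0 nat) set \<Rightarrow> ('n, 'k::field) mpoly set" where
  "mon_ideal E = {f. keys f \<subseteq> E}"

primrec exp_power :: "'a::comm_monoid_add set \<Rightarrow> nat \<Rightarrow> 'a set" where
  "exp_power E 0 = UNIV"
| "exp_power E (Suc k) = {a + b | a b. a \<in> E \<and> b \<in> exp_power E k}"

lemma upclosedD: "upclosed E \<Longrightarrow> m \<in> E \<Longrightarrow> m + v \<in> E"
  by (simp add: upclosed_def)

lemma upclosed_multiples: "upclosed {a + v | a v. a \<in> A}"
  by (fastforce simp: upclosed_def add.assoc)

lemma upclosed_plus:
  assumes "upclosed E'"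
  shows "upclosed {a + b | a b. a \<in> E \<and> b \<in> E'}"
  unfolding upclosed_def
proof (intro ballI allI)
  fix m v assume "m \<in> {a + b | a b. a \<in> E \<and> b \<in> E'}"
  then obtain a b where ab: "m = a + b" "a \<in> E" "b \<in> E'" by blast
  then have "m + v = a + (b + v)" "b + v \<in> E'" using assms by (auto simp: add.assoc upclosed_def)
  then show "m + v \<in> {a + b | a b. a \<in> E \<and> b \<in> E'}" using ab by blast
qed

lemma upclosed_exp_power: "upclosed E \<Longrightarrow> upclosed (exp_power E k)"
proof (induction k)
  case (Suc k)
  then show ?case using upclosed_plus by simp
qed (simp add: upclosed_def)

lemma monomial_mult: "monomial a * monomial b = monomial (a + b)"
  by (simp add: monomial_def mult_single)

lemma keys_monomial [simp]: "keys (monomial m) = {m}"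
  by (simp add: monomial_def)

lemma lookup_monomial_times_add: "lookup (monomial a * f) (a + v) = lookup f v"
proof -
  have "lookup (monomial a * f) (a + v) =
      Sum_any (\<lambda>l. lookup (monomial a) l * Sum_any (\<lambda>q. lookup f q when a + v = l + q))"
    by (rule lookup_mult)
  also have "\<dots> = (\<Sum>l\<in>{a}. lookup (monomial a) l * Sum_any (\<lambda>q. lookup f q when a + v = l + q))"
    by (rule Sum_any.expand_superset) (auto simp: monomial_def lookup_single when_def)
  also have "\<dots> = lookup f v" by (simp add: monomial_def)
  finally show ?thesis .
qed

lemma lookup_monomial_times_eq_0:
  assumes "\<nexists>v. m = a + v"
  shows "lookup (monomial a * f) m = 0"
proof -
  have "m \<notin> keys (monomial a * f)"
    using keys_mult[of "monomial a" f] assms by auto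
  then show ?thesis by (simp add: in_keys_iff)
qed

lemma single_eq_const_times_monomial: "Poly_Mapping.single m c = Poly_Mapping.single 0 c * monomial m"
  by (simp add: monomial_def mult_single)

lemma poly_mapping_sum_single: "(\<Sum>m\<in>keys f. Poly_Mapping.single m (lookup f m)) = f"
proof (rule poly_mapping_eqI)
  fix k
  have "lookup (\<Sum>m\<in>keys f. Poly_Mapping.single m (lookup f m)) k =
      (\<Sum>m\<in>keys f. if m = k then lookup f m else 0)"
    unfolding lookup_sum by (intro sum.cong) (auto simp: lookup_single when_def)
  also have "\<dots> = lookup f k" by (simp add: in_keys_iff)
  finally show "lookup (\<Sum>m\<in>keys f. Poly_Mapping.single m (lookup f m)) k = lookup f k" .
qed

lemma monomial_in_mon_ideal [simp]: "monomial m \<in> mon_ideal E \<longleftrightarrow> m \<in> E"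
  by (simp add: mon_ideal_def)

lemma subspace_mon_ideal:
  assumes "upclosed E"
  shows "module.subspace (*) (mon_ideal E)"
proof (rule module.subspaceI[OF module_mult])
  fix f g :: "('a, 'b) mpoly"
  assume "f \<in> mon_ideal E" "g \<in> mon_ideal E"
  then show "f + g \<in> mon_ideal E" using keys_add[of f g] by (auto simp: mon_ideal_def)
next
  fix c f :: "('a, 'b) mpoly"
  assume f: "f \<in> mon_ideal E"
  have "keys (f * c) \<subseteq> E"
    using keys_mult[of f c] f assms by (fastforce simp: mon_ideal_def upclosed_def)
  then show "c * f \<in> mon_ideal E" by (simp add: mon_ideal_def mult.commute)
qed (simp add: mon_ideal_def)

lemma mon_ideal_subset:
  fixes J :: "('n, 'k::field) mpoly set"
  assumes J: "module.subspace (*) J" and E: "\<And>m. m \<in> E \<Longrightarrow> monomial m \<in> J"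
  shows "mon_ideal E \<subseteq> J"
proof
  fix f :: "('n, 'k) mpoly" assume f: "f \<in> mon_ideal E"
  have "(\<Sum>m\<in>keys f. Poly_Mapping.single m (lookup f m)) \<in> J"
  proof (rule module.subspace_sum[OF module_mult J])
    fix m assume "m \<in> keys f"
    then have "monomial m \<in> J" using f by (intro E) (auto simp: mon_ideal_def)
    then show "Poly_Mapping.single m (lookup f m) \<in> J"
      by (subst single_eq_const_times_monomial) (rule module.subspace_scale[OF module_mult J])
  qed
  then show "f \<in> J" by (simp add: poly_mapping_sum_single)
qed

lemma ideal_generated_monomials:
  "ideal_generated (monomial ` A) = mon_ideal {a + v | a v. a \<in> A}"
proof
  show "ideal_generated (monomial ` A) \<subseteq> mon_ideal {a + v | a v. a \<in> A}"
    unfolding ideal_generated_def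
  proof (rule module.span_minimal[OF module_mult _ subspace_mon_ideal[OF upclosed_multiples]])
    show "monomial ` A \<subseteq> mon_ideal {a + v | a v. a \<in> A}"
      by (auto intro: exI[of _ 0] simp: image_subset_iff) (metis add.right_neutral)
  qed
  show "mon_ideal {a + v | a v. a \<in> A} \<subseteq> ideal_generated (monomial ` A)"
  proof (rule mon_ideal_subset)
    show "module.subspace (*) (ideal_generated (monomial ` A))"
      unfolding ideal_generated_def by (rule module.subspace_span[OF module_mult])
    fix m assume "m \<in> {a + v | a v. a \<in> A}"
    then obtain a v where "m = v + a" "a \<in> A" by (auto simp: add.commute)
    then show "monomial m \<in> ideal_generated (monomial ` A)"
      unfolding ideal_generated_def \<open>m = v + a\<close> monomial_mult[symmetric]
      by (intro module.span_scale[OF module_mult] module.span_base[OF module_mult] imageI)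
  qed
qed

lemma monomial_idealE:
  assumes "monomial_ideal I"
  obtains E where "upclosed E" "I = mon_ideal E"
proof -
  obtain A where "I = ideal_generated (monomial ` A)"
    using assms unfolding monomial_ideal_def by blast
  then show thesis using that[OF upclosed_multiples] ideal_generated_monomials by blast
qed

lemma ideal_mult_mon_ideal:
  assumes "upclosed E" "upclosed E'"
  shows "ideal_mult (mon_ideal E) (mon_ideal E') = mon_ideal {a + b | a b. a \<in> E \<and> b \<in> E'}"
    (is "?L = mon_ideal ?S")
proof
  have up: "upclosed ?S"
    using assms(2) by (rule upclosed_plus)
  show "?L \<subseteq> mon_ideal ?S"
    unfolding ideal_mult_def ideal_generated_def
  proof (rule module.span_minimal[OF module_mult _ subspace_mon_ideal[OF up]], safe)
    fix f g :: "('a, 'b) mpoly" assume "f \<in> mon_ideal E" "g \<in> mon_ideal E'"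
    then show "f * g \<in> mon_ideal ?S" using keys_mult[of f g] unfolding mon_ideal_def by blast
  qed
  show "mon_ideal ?S \<subseteq> ?L"
  proof (rule mon_ideal_subset)
    show "module.subspace (*) ?L"
      unfolding ideal_mult_def ideal_generated_def by (rule module.subspace_span[OF module_mult])
    fix m assume "m \<in> ?S"
    then obtain a b where "m = a + b" "a \<in> E" "b \<in> E'" by blast
    then show "monomial m \<in> ?L"
      unfolding ideal_mult_def ideal_generated_def
      by (intro module.span_base[OF module_mult])
        (intro CollectI exI[of _ "monomial a"] exI[of _ "monomial b"], simp add: monomial_mult)
  qed
qed

lemma ideal_power_mon_ideal:
  "upclosed E \<Longrightarrow> ideal_power (mon_ideal E) k = mon_ideal (exp_power E k)"
proof (induction k)
  case 0
  then show ?case by (simp add: mon_ideal_def)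
next
  case (Suc k)
  then show ?case by (simp add: ideal_mult_mon_ideal upclosed_exp_power)
qed

text \<open>Multiplication by a single monomial shifts the support injectively, so no terms cancel
  and membership can be tested exponent by exponent.\<close>

lemma ideal_colon_mon_ideal:
  assumes "upclosed E"
  shows "ideal_colon (mon_ideal E) (mon_ideal E') = mon_ideal {m. \<forall>v\<in>E'. m + v \<in> E}"
proof (intro equalityI subsetI)
  fix f :: "('a, 'b) mpoly"
  assume f: "f \<in> ideal_colon (mon_ideal E) (mon_ideal E')"
  show "f \<in> mon_ideal {m. \<forall>v\<in>E'. m + v \<in> E}"
    unfolding mon_ideal_def
  proof safe
    fix m v assume m: "m \<in> keys f" and "v \<in> E'"
    then have "f * monomial v \<in> mon_ideal E"
      using f by (simp add: ideal_colon_def)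
    moreover have "m + v \<in> keys (f * monomial v)"
      using m lookup_monomial_times_add[of v f m] by (simp add: in_keys_iff ac_simps)
    ultimately show "m + v \<in> E" by (auto simp: mon_ideal_def)
  qed
next
  fix f :: "('a, 'b) mpoly"
  assume "f \<in> mon_ideal {m. \<forall>v\<in>E'. m + v \<in> E}"
  then show "f \<in> ideal_colon (mon_ideal E) (mon_ideal E')"
    unfolding ideal_colon_def mon_ideal_def using keys_mult[of f] by fastforce
qed

section \<open>Total degree, powers of the maximal ideal, and saturation numbers in terms of
  exponents\<close>

lemma lookup_le_imp_ex_add:
  fixes a m :: "'n \<Rightarrow>\<^sub>0 nat"
  assumes "\<And>j. lookup a j \<le> lookup m j"
  shows "\<exists>v. m = a + v"
  by (rule exI[of _ "m - a"], rule poly_mapping_eqI) (simp add: assms lookup_add lookup_minus)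

lemma mdegree_add [simp]: "mdegree (a + b) = mdegree a + mdegree b"
  by (simp add: mdegree_def lookup_add sum.distrib)

lemma mdegree_0 [simp]: "mdegree 0 = 0"
  by (simp add: mdegree_def)

lemma mdegree_single [simp]: "mdegree (Poly_Mapping.single i c) = c"
  by (simp add: mdegree_def lookup_single when_def)

lemma lookup_le_mdegree: "lookup m i \<le> mdegree m"
  unfolding mdegree_def by (rule member_le_sum) auto

lemma mdegree_eq_0_iff [simp]: "mdegree m = 0 \<longleftrightarrow> m = 0"
  by (auto simp: mdegree_def intro: poly_mapping_eqI)

lemma mdegree_Suc_split:
  assumes "mdegree m > 0"
  obtains i v where "m = Poly_Mapping.single i 1 + v"
proof -
  obtain i where "lookup m i \<noteq> 0"
    using assms unfolding mdegree_def by (metis less_numeral_extra(3) sum.neutral)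
  then have "\<exists>v. m = Poly_Mapping.single i 1 + v"
    by (intro lookup_le_imp_ex_add) (auto simp: lookup_single when_def)
  with that show ?thesis by blast
qed

lemma graded_max_ideal_eq: "graded_max_ideal = mon_ideal {m. mdegree m \<ge> 1}"
proof -
  have "{a + v | a v. a \<in> (\<lambda>i. Poly_Mapping.single i 1) ` UNIV} = {m :: 'a::finite \<Rightarrow>\<^sub>0 nat. mdegree m \<ge> 1}"
  proof (intro equalityI subsetI)
    fix m :: "'a \<Rightarrow>\<^sub>0 nat" assume "m \<in> {m. mdegree m \<ge> 1}"
    then obtain i v where "m = Poly_Mapping.single i 1 + v"
      by (elim CollectE mdegree_Suc_split[of m, rotated]) auto
    then show "m \<in> {a + v | a v. a \<in> (\<lambda>i. Poly_Mapping.single i 1) ` UNIV}" by auto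
  qed auto
  then show ?thesis
    unfolding graded_max_ideal_def var_def
    using ideal_generated_monomials[of "range (\<lambda>i :: 'a. Poly_Mapping.single i 1)"]
    by (simp only: image_image)
qed

lemma upclosed_mdegree_ge: "upclosed {m. k \<le> mdegree m}"
  by (auto simp: upclosed_def)

lemma exp_power_mdegree: "exp_power {m. mdegree m \<ge> 1} k = {m. mdegree m \<ge> k}"
proof (induction k)
  case (Suc k)
  show ?case
  proof (intro equalityI subsetI)
    fix m :: "'a \<Rightarrow>\<^sub>0 nat" assume "m \<in> {m. mdegree m \<ge> Suc k}"
    moreover from this obtain i v where "m = Poly_Mapping.single i 1 + v"
      by (elim CollectE mdegree_Suc_split[of m, rotated]) auto
    ultimately show "m \<in> exp_power {m. mdegree m \<ge> 1} (Suc k)"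
      unfolding exp_power.simps Suc.IH by (intro CollectI exI[of _ "Poly_Mapping.single i 1"] exI[of _ v]) simp
  qed (auto simp: Suc.IH[unfolded One_nat_def])
qed simp

lemma graded_max_ideal_power: "ideal_power graded_max_ideal k = mon_ideal {m. mdegree m \<ge> k}"
  unfolding graded_max_ideal_eq
  by (simp only: ideal_power_mon_ideal[OF upclosed_mdegree_ge] exp_power_mdegree)

lemma sat_mon_ideal:
  assumes "upclosed E"
  shows "sat (mon_ideal E :: ('n::finite, 'k::field) mpoly set) =
    (LEAST k. {m. \<forall>v. mdegree v \<ge> k + 1 \<longrightarrow> m + v \<in> E} = {m. \<forall>v. mdegree v \<ge> k \<longrightarrow> m + v \<in> E})"
proof -
  have "mon_ideal A = (mon_ideal B :: ('n, 'k) mpoly set) \<longleftrightarrow> A = B" for A B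
    by (metis monomial_in_mon_ideal subsetI subset_antisym)
  then show ?thesis
    unfolding sat_def graded_max_ideal_power ideal_colon_mon_ideal[OF assms] by simp
qed

text \<open>The support of a homogeneous element of degree \<open>e\<close> consists of elements of
  \<open>E\<close> of degree \<open>e\<close>, so the monomials of that degree already
  generate.\<close>

lemma mon_ideal_generated_in_degree:
  assumes "upclosed E" "ideal_generated_in_degree (int e) (mon_ideal E :: ('n::finite, 'k::field) mpoly set)"
    and "m \<in> E"
  shows "\<exists>g\<in>E. mdegree g = e \<and> (\<exists>v. m = g + v)"
proof -
  let ?S = "{g + v | g v. g \<in> {g\<in>E. mdegree g = e}}"
  let ?I = "mon_ideal E :: ('n, 'k) mpoly set"
  have "ideal_generated {f \<in> ?I. homogeneous (int e) f} \<subseteq> mon_ideal ?S"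
    unfolding ideal_generated_def
  proof (rule module.span_minimal[OF module_mult _ subspace_mon_ideal[OF upclosed_multiples]])
    show "{f \<in> ?I. homogeneous (int e) f} \<subseteq> mon_ideal ?S"
    proof safe
      fix f :: "('n, 'k) mpoly" assume f: "f \<in> ?I" "homogeneous (int e) f"
      show "f \<in> mon_ideal ?S"
        unfolding mon_ideal_def
      proof (rule CollectI, rule subsetI)
        fix m assume "m \<in> keys f"
        then have "m \<in> E" "mdegree m = e" using f by (auto simp: mon_ideal_def homogeneous_def)
        moreover have "m = m + 0" by simp
        ultimately show "m \<in> ?S" by blast
      qed
    qed
  qed
  moreover have "monomial m \<in> ?I" using assms by simp
  ultimately have "monomial m \<in> (mon_ideal ?S :: ('n, 'k) mpoly set)"
    using assms(2) unfolding ideal_generated_in_degree_def by blast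
  then show ?thesis by auto
qed

section \<open>Division by variables\<close>

text \<open>Divides the terms divisible by the variable and drops the others. It is a left inverse
  of multiplication by that variable and commutes with multiplication by every other one, as the
  operators \<open>Q\<close> of the Koszul argument must.\<close>

definition quo :: "'n \<Rightarrow> ('n, 'k::field) mpoly \<Rightarrow> ('n, 'k) mpoly" where
  "quo i f = Poly_Mapping.map_key ((+) (Poly_Mapping.single i 1)) f"

definition vec_quo :: "'n \<Rightarrow> ('n, 'k::field) mvec \<Rightarrow> ('n, 'k) mvec" where
  "vec_quo i v = Poly_Mapping.map (quo i) v"

lemma lookup_quo: "lookup (quo i f) m = lookup f (Poly_Mapping.single i 1 + m)"
  unfolding quo_def by (simp add: Poly_Mapping.map_key.rep_eq)

lemma quo_0 [simp]: "quo i 0 = 0"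
  by (rule poly_mapping_eqI) (simp add: lookup_quo)

lemma quo_diff: "quo i (f - g) = quo i f - quo i g"
  by (rule poly_mapping_eqI) (simp add: lookup_quo lookup_minus)

lemma quo_var_same: "quo i (var i * f) = f"
  by (rule poly_mapping_eqI) (simp add: lookup_quo var_def lookup_monomial_times_add)

lemma quo_var:
  assumes "i \<noteq> j"
  shows "quo i (var j * f) = var j * quo i f"
proof (rule poly_mapping_eqI)
  fix m
  let ?ei = "Poly_Mapping.single i (1::nat)" and ?ej = "Poly_Mapping.single j (1::nat)"
  show "lookup (quo i (var j * f)) m = lookup (var j * quo i f) m"
  proof (cases "\<exists>v. m = ?ej + v")
    case True
    then obtain v where v: "m = ?ej + v" by blast
    have "?ei + m = ?ej + (?ei + v)" by (simp add: v ac_simps)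
    then show ?thesis by (simp add: v lookup_quo var_def lookup_monomial_times_add)
  next
    case False
    have "\<nexists>v. ?ei + m = ?ej + v"
    proof
      assume "\<exists>v. ?ei + m = ?ej + v"
      then obtain v where "?ei + m = ?ej + v" by blast
      then have "lookup (?ei + m) j = lookup (?ej + v) j" by simp
      then have "lookup m j \<ge> 1" using assms by (simp add: lookup_add lookup_single)
      then have "\<exists>v. m = ?ej + v"
        by (intro lookup_le_imp_ex_add) (auto simp: lookup_single when_def)
      then show False using False by blast
    qed
    then show ?thesis using False by (simp add: lookup_quo var_def lookup_monomial_times_eq_0)
  qed
qed

lemma lookup_vec_quo: "lookup (vec_quo i v) j = quo i (lookup v j)"
  by (simp add: vec_quo_def Poly_Mapping.map.rep_eq when_def)

lemma free_module_iff: "v \<in> free_module r \<longleftrightarrow> (\<forall>j\<ge>r. lookup v j = 0)"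
  unfolding free_module_def using in_keys_iff[of _ v] by (auto simp: not_le[symmetric])

lemma subspace_free_module: "vec_module.subspace (free_module r)"
  by (rule vec_module.subspaceI) (auto simp: free_module_iff lookup_add)

lemma koszul_free_module:
  assumes "inj_on x {..<n}"
  shows "koszul (\<lambda>i. vec_scale (var (x i) :: ('n, 'k::field) mpoly)) (\<lambda>i. vec_quo (x i)) n (free_module r)"
proof
  fix i j :: nat and u v :: "('n, 'k) mvec"
  show "vec_scale (var (x i)) (vec_scale (var (x j)) v) = vec_scale (var (x j)) (vec_scale (var (x i)) v)"
    by (rule vec_module.scale_left_commute)
  show "vec_quo (x i) (u - v) = vec_quo (x i) u - vec_quo (x i) v"
    by (rule poly_mapping_eqI) (simp add: lookup_vec_quo lookup_minus quo_diff)
  show "vec_quo (x i) (vec_scale (var (x i)) v) = v"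
    by (rule poly_mapping_eqI) (simp add: lookup_vec_quo quo_var_same)
  show "vec_quo (x i) (vec_scale (var (x j)) v) = vec_scale (var (x j)) (vec_quo (x i) v)"
    if "i < n" "j < n" "i \<noteq> j"
  proof -
    have "x i \<noteq> x j" using assms that by (auto dest: inj_onD)
    then show ?thesis by (intro poly_mapping_eqI) (simp add: lookup_vec_quo quo_var)
  qed
qed (auto simp: vec_module.scale_right_diff_distrib free_module_iff lookup_minus lookup_vec_quo)

section \<open>Graded Nakayama\<close>

lemma inj_var: "inj (var :: 'n \<Rightarrow> ('n, 'k::field) mpoly)"
proof (rule injI)
  fix i j :: 'n assume "(var i :: ('n, 'k) mpoly) = var j"
  then have "keys (var i :: ('n, 'k) mpoly) = keys (var j :: ('n, 'k) mpoly)" by simp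
  then have "keys (Poly_Mapping.single i (1::nat)) = keys (Poly_Mapping.single j (1::nat))"
    by (simp add: var_def)
  then show "i = j" by simp
qed

lemma graded_max_idealE:
  assumes "f \<in> (graded_max_ideal :: ('n::finite, 'k::field) mpoly set)"
  obtains g where "f = (\<Sum>i\<in>UNIV. var i * g i)"
proof -
  obtain u where "f = (\<Sum>v\<in>range var. u v * v)"
    using assms unfolding graded_max_ideal_def ideal_generated_def
    by (subst (asm) module.span_finite[OF module_mult]) auto
  then have "f = (\<Sum>i\<in>UNIV. var i * u (var i))"
    by (simp add: sum.reindex[OF inj_var] mult.commute)
  then show thesis by (rule that)
qed

lemma mpoly_split_const:
  fixes f :: "('n::finite, 'k::field) mpoly"
  obtains c g where "f = Poly_Mapping.single 0 c + (\<Sum>i\<in>UNIV. var i * g i)"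
proof -
  have "f - Poly_Mapping.single 0 (lookup f 0) \<in> mon_ideal {m. mdegree m \<ge> 1}"
    unfolding mon_ideal_def
  proof safe
    fix m assume "m \<in> keys (f - Poly_Mapping.single 0 (lookup f 0))"
    then have "m \<noteq> 0" by (auto simp: in_keys_iff lookup_minus)
    then show "mdegree m \<ge> 1" using mdegree_eq_0_iff[of m] by linarith
  qed
  then obtain g where "f - Poly_Mapping.single 0 (lookup f 0) = (\<Sum>i\<in>UNIV. var i * g i)"
    unfolding graded_max_ideal_eq[symmetric] by (rule graded_max_idealE)
  then show thesis by (intro that[of "lookup f 0" g]) (simp add: algebra_simps)
qed

text \<open>The common core of the two Nakayama statements, for ideals and for syzygy modules.
  \<open>H\<close> stands for the homogeneous elements of the generating degree, which are closed
  under constant scalars; the non-constant part of each coefficient goes into the multiples of the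
  variables.\<close>

lemma span_split_const:
  fixes s :: "('n::finite, 'k::field) mpoly \<Rightarrow> 'v::ab_group_add \<Rightarrow> 'v"
  assumes s: "module s"
    and H: "B \<subseteq> H" "0 \<in> H" "\<And>u v. u \<in> H \<Longrightarrow> v \<in> H \<Longrightarrow> u + v \<in> H"
      "\<And>c v. v \<in> H \<Longrightarrow> s (Poly_Mapping.single 0 c) v \<in> H"
    and z: "z \<in> module.span s B"
  shows "\<exists>z\<^sub>0\<in>H. \<exists>w. range w \<subseteq> module.span s B \<and> z = z\<^sub>0 + (\<Sum>i\<in>UNIV. s (var i) (w i))"
proof -
  interpret module s by (rule s)
  show ?thesis
    using z
  proof (induction rule: span_induct_alt)
    case base
    show ?case using H by (intro bexI[of _ 0] exI[of _ "\<lambda>_. 0"]) (auto simp: span_zero)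
  next
    case (step c u z)
    then obtain z\<^sub>0 w where zw: "z\<^sub>0 \<in> H" "range w \<subseteq> span B" "z = z\<^sub>0 + (\<Sum>i\<in>UNIV. s (var i) (w i))"
      by blast
    obtain a g where c: "c = Poly_Mapping.single 0 a + (\<Sum>i\<in>UNIV. var i * g i)"
      by (rule mpoly_split_const)
    have "s c u = s (Poly_Mapping.single 0 a) u + (\<Sum>i\<in>UNIV. s (var i) (s (g i) u))"
      by (simp add: c scale_left_distrib scale_sum_left)
    then have "s c u + z =
        (s (Poly_Mapping.single 0 a) u + z\<^sub>0) + (\<Sum>i\<in>UNIV. s (var i) (s (g i) u + w i))"
      by (simp add: zw scale_right_distrib sum.distrib)
    moreover have "s (Poly_Mapping.single 0 a) u + z\<^sub>0 \<in> H" using H step zw by blast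
    moreover have "range (\<lambda>i. s (g i) u + w i) \<subseteq> span B"
      using zw(2) step(1) by (auto intro!: span_add span_scale intro: span_base)
    ultimately show ?case by blast
  qed
qed

text \<open>The filtration of the graded free module by total degree at least \<open>t\<close>.
  Unlike homogeneity, it is stable under multiplication by arbitrary polynomials.\<close>

definition vec_order :: "(nat \<Rightarrow> int) \<Rightarrow> int \<Rightarrow> ('n::finite, 'k::field) mvec set" where
  "vec_order deg t = {v. \<forall>j. lookup v j \<in> mon_ideal {m. t \<le> int (mdegree m) + deg j}}"

lemma subspace_degree_ge: 
  "module.subspace (*) (mon_ideal {m. t \<le> int (mdegree m) + d} :: ('n::finite, 'k::field) mpoly set)"
  by (rule subspace_mon_ideal) (auto simp: upclosed_def)

lemma subspace_vec_order: "vec_module.subspace (vec_order deg t)"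
  unfolding vec_order_def
  by (intro vec_module.subspaceI)
    (simp_all add: lookup_add module.subspace_0[OF module_mult subspace_degree_ge]
      module.subspace_add[OF module_mult subspace_degree_ge]
      module.subspace_scale[OF module_mult subspace_degree_ge])

lemma var_times_degree_ge:
  assumes "f \<in> mon_ideal {m. t \<le> int (mdegree m) + d}"
  shows "var i * f \<in> mon_ideal {m. t + 1 \<le> int (mdegree m) + d}"
  using keys_mult[of "var i" f] assms by (fastforce simp: mon_ideal_def var_def)

lemma vec_scale_var_order:
  "v \<in> vec_order deg t \<Longrightarrow> vec_scale (var i) v \<in> vec_order deg (t + 1)"
  unfolding vec_order_def by (simp add: var_times_degree_ge)

lemma vec_homogeneous_imp_order: "vec_homogeneous deg t v \<Longrightarrow> v \<in> vec_order deg t"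
  by (force simp: vec_order_def vec_homogeneous_def homogeneous_def mon_ideal_def)

lemma vec_homogeneous_order_eq_0:
  assumes "vec_homogeneous deg t v" "v \<in> vec_order deg t'" "t < t'"
  shows "v = 0"
proof (rule poly_mapping_eqI)
  fix j
  have "keys (lookup v j) = {}"
    using assms by (fastforce simp: vec_order_def vec_homogeneous_def homogeneous_def mon_ideal_def)
  then show "lookup v j = lookup 0 j" by simp
qed

lemma const_times_keys: "keys (Poly_Mapping.single 0 c * f) \<subseteq> keys f"
  using keys_mult[of "Poly_Mapping.single 0 c" f] by (auto split: if_splits)

lemma submodule_generated_in_degree_ge:
  assumes "submodule_generated_in_degree deg t M"
  shows "M \<subseteq> vec_order deg t"
proof -
  have "M = vec_span {v \<in> M. vec_homogeneous deg t v}"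
    using assms by (simp add: submodule_generated_in_degree_def)
  also have "\<dots> \<subseteq> vec_order deg t"
    by (intro vec_module.span_minimal subspace_vec_order) (auto intro: vec_homogeneous_imp_order)
  finally show ?thesis .
qed

text \<open>Modulo multiples of the variables, \<open>z\<close> is a constant combination of
  generators of degree \<open>t\<close>. That combination is homogeneous of degree \<open>t\<close>
  and yet of order at least \<open>t + 1\<close>, hence zero.\<close>

lemma submodule_nakayama:
  fixes M :: "('n::finite, 'k::field) mvec set"
  assumes M: "submodule_generated_in_degree deg t M" and z: "z \<in> M" "z \<in> vec_order deg (t + 1)"
  obtains w where "range w \<subseteq> M" "z = (\<Sum>i\<in>UNIV. vec_scale (var i) (w i))"
proof -
  let ?B = "{v \<in> M. vec_homogeneous deg t v}"
  have MB: "M = vec_span ?B" using M by (simp add: submodule_generated_in_degree_def)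
  have "\<exists>z\<^sub>0\<in>{v. vec_homogeneous deg t v}. \<exists>w. range w \<subseteq> vec_span ?B \<and>
      z = z\<^sub>0 + (\<Sum>i\<in>UNIV. vec_scale (var i) (w i))"
    unfolding vec_span_def
  proof (rule span_split_const)
    show "module (vec_scale :: ('n, 'k) mpoly \<Rightarrow> _)" by (rule vec_module.module_axioms)
    show "z \<in> module.span vec_scale ?B" using z(1) MB unfolding vec_span_def by simp
  next
    fix u v :: "('n, 'k) mvec"
    assume "u \<in> {v. vec_homogeneous deg t v}" "v \<in> {v. vec_homogeneous deg t v}"
    then show "u + v \<in> {v. vec_homogeneous deg t v}"
      using keys_add by (fastforce simp: vec_homogeneous_def homogeneous_def lookup_add)
  next
    fix c :: 'k and v :: "('n, 'k) mvec"
    assume "v \<in> {v. vec_homogeneous deg t v}"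
    then show "vec_scale (Poly_Mapping.single 0 c) v \<in> {v. vec_homogeneous deg t v}"
      using const_times_keys by (fastforce simp: vec_homogeneous_def homogeneous_def)
  qed (auto simp: vec_homogeneous_def homogeneous_def)
  then obtain z\<^sub>0 w where w: "vec_homogeneous deg t z\<^sub>0" "range w \<subseteq> M"
      "z = z\<^sub>0 + (\<Sum>i\<in>UNIV. vec_scale (var i) (w i))"
    using MB by auto
  have "range w \<subseteq> vec_order deg t" using w submodule_generated_in_degree_ge[OF M] by blast
  then have "(\<Sum>i\<in>UNIV. vec_scale (var i) (w i)) \<in> vec_order deg (t + 1)"
    by (intro vec_module.subspace_sum[OF subspace_vec_order] vec_scale_var_order) auto
  then have "z - (\<Sum>i\<in>UNIV. vec_scale (var i) (w i)) \<in> vec_order deg (t + 1)"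
    using z by (intro vec_module.subspace_diff[OF subspace_vec_order])
  then have "z\<^sub>0 \<in> vec_order deg (t + 1)" by (simp add: w)
  then have "z\<^sub>0 = 0" using vec_homogeneous_order_eq_0[OF w(1)] by simp
  then show thesis using that w by simp
qed

lemma ideal_generated_in_degree_ge:
  assumes J: "ideal_generated_in_degree (int e) J"
  shows "J \<subseteq> mon_ideal {m. e \<le> mdegree m}"
proof -
  have "J = ideal_generated {f \<in> J. homogeneous (int e) f}"
    using J by (simp add: ideal_generated_in_degree_def)
  also have "\<dots> \<subseteq> mon_ideal {m. e \<le> mdegree m}"
    unfolding ideal_generated_def
    by (rule module.span_minimal[OF module_mult _ subspace_mon_ideal[OF upclosed_mdegree_ge]])
      (auto simp: mon_ideal_def homogeneous_def)
  finally show ?thesis .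
qed

lemma ideal_nakayama:
  fixes J :: "('n::finite, 'k::field) mpoly set"
  assumes J: "ideal_generated_in_degree (int e) J"
    and z: "z \<in> J" "z \<in> mon_ideal {m. e + 1 \<le> mdegree m}"
  obtains w where "range w \<subseteq> J" "z = (\<Sum>i\<in>UNIV. var i * w i)"
proof -
  let ?B = "{f \<in> J. homogeneous (int e) f}"
  have JB: "J = ideal_generated ?B" using J by (simp add: ideal_generated_in_degree_def)
  have "\<exists>z\<^sub>0\<in>{f. homogeneous (int e) f}. \<exists>w. range w \<subseteq> ideal_generated ?B \<and>
      z = z\<^sub>0 + (\<Sum>i\<in>UNIV. var i * w i)"
    unfolding ideal_generated_def
  proof (rule span_split_const[OF module_mult])
    show "z \<in> module.span (*) ?B" using z(1) JB unfolding ideal_generated_def by simp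
  next
    fix u v :: "('n, 'k) mpoly"
    assume "u \<in> {f. homogeneous (int e) f}" "v \<in> {f. homogeneous (int e) f}"
    then show "u + v \<in> {f. homogeneous (int e) f}"
      using keys_add[of u v] by (fastforce simp: homogeneous_def)
  next
    fix c :: 'k and v :: "('n, 'k) mpoly"
    assume "v \<in> {f. homogeneous (int e) f}"
    then show "Poly_Mapping.single 0 c * v \<in> {f. homogeneous (int e) f}"
      using const_times_keys[of c v] by (fastforce simp: homogeneous_def)
  qed (auto simp: homogeneous_def)
  then obtain z\<^sub>0 w where w: "homogeneous (int e) z\<^sub>0" "range w \<subseteq> J"
      "z = z\<^sub>0 + (\<Sum>i\<in>UNIV. var i * w i)"
    using JB by auto
  let ?S = "mon_ideal {m. e + 1 \<le> mdegree m} :: ('n, 'k) mpoly set"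
  have S: "module.subspace (*) ?S" by (rule subspace_mon_ideal[OF upclosed_mdegree_ge])
  have "(\<Sum>i\<in>UNIV. var i * w i) \<in> ?S"
  proof (rule module.subspace_sum[OF module_mult S])
    fix i
    have "keys (w i) \<subseteq> {m. e \<le> mdegree m}"
      using w(2) ideal_generated_in_degree_ge[OF J] by (auto simp: mon_ideal_def)
    then show "var i * w i \<in> ?S"
      using keys_mult[of "var i" "w i"] by (fastforce simp: mon_ideal_def var_def)
  qed
  then have "z - (\<Sum>i\<in>UNIV. var i * w i) \<in> ?S"
    by (intro module.subspace_diff[OF module_mult S] z)
  then have "keys z\<^sub>0 \<subseteq> {m. e + 1 \<le> mdegree m}" by (simp add: w mon_ideal_def)
  moreover have "\<forall>m\<in>keys z\<^sub>0. mdegree m = e" using w by (simp add: homogeneous_def)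
  ultimately have "keys z\<^sub>0 = {}" by fastforce
  then show thesis using that w by simp
qed

section \<open>Socle degrees of an ideal with linear resolution\<close>

definition basis_vec :: "nat \<Rightarrow> (nat \<Rightarrow>\<^sub>0 'a::comm_ring_1)" where
  "basis_vec j = Poly_Mapping.single j 1"

lemma basis_vec_in_free_module: "j < r \<Longrightarrow> basis_vec j \<in> free_module r"
  by (simp add: basis_vec_def free_module_iff lookup_single)

lemma vec_homogeneous_basis_vec: "vec_homogeneous deg (deg j) (basis_vec j)"
  by (auto simp: vec_homogeneous_def basis_vec_def homogeneous_def lookup_single when_def)

lemma lookup_basis_vec_same:
  "lookup (basis_vec j) j \<notin> (graded_max_ideal :: ('n::finite, 'k::field) mpoly set)"
  by (auto simp: basis_vec_def graded_max_ideal_eq mon_ideal_def)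

locale linear_free_resolution = minimal_graded_free_resolution I rk deg \<epsilon> \<delta>
  for I :: "('n::finite, 'k::field) mpoly set" and rk deg \<epsilon> \<delta> +
  fixes e :: nat
  assumes ideal_linear: "ideal_generated_in_degree (int e) I"
    and syzygies_linear:
      "submodule_generated_in_degree (deg i) (int (e + (i + 1))) (\<delta> i ` free_module (rk (Suc i)))"
begin

lemma basis_vec_notin_image: "v \<in> free_module (rk (Suc i)) \<Longrightarrow> \<delta> i v \<noteq> basis_vec j"
  using minimal lookup_basis_vec_same by metis

text \<open>Linearity is assumed for the syzygy modules, and minimality carries it over to the
  shifts. A basis vector killed by the map would lie in the image of the next one, contradicting
  minimality; so it has a nonzero homogeneous image of its own degree, in a module generated in
  degree \<open>e + i\<close>.\<close>

lemma deg_ge: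
  assumes "j < rk i"
  shows "int (e + i) \<le> deg i j"
proof (cases i)
  case 0
  have b: "basis_vec j \<in> free_module (rk 0)" using assms 0 by (simp add: basis_vec_in_free_module)
  have "\<epsilon> (basis_vec j) \<noteq> 0"
  proof
    assume "\<epsilon> (basis_vec j) = 0"
    then have "basis_vec j \<in> \<delta> 0 ` free_module (rk 1)" using exact_0 b by simp
    then show False using basis_vec_notin_image[of _ 0 j] by (metis One_nat_def imageE)
  qed
  then obtain m where m: "m \<in> keys (\<epsilon> (basis_vec j))" by fastforce
  have "\<epsilon> (basis_vec j) \<in> I" using exact_ideal b by blast
  then have "e \<le> mdegree m"
    using ideal_generated_in_degree_ge[OF ideal_linear] m by (auto simp: mon_ideal_def)
  moreover have "homogeneous (deg 0 j) (\<epsilon> (basis_vec j))"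
    by (rule graded_augmentation[OF b vec_homogeneous_basis_vec])
  then have "int (mdegree m) = deg 0 j" using m by (simp add: homogeneous_def)
  ultimately show ?thesis using 0 by simp
next
  case (Suc q)
  let ?Z = "\<delta> q ` free_module (rk (Suc q))"
  have b: "basis_vec j \<in> free_module (rk (Suc q))" using assms Suc by (simp add: basis_vec_in_free_module)
  have "\<delta> q (basis_vec j) \<noteq> 0"
  proof
    assume "\<delta> q (basis_vec j) = 0"
    then have "basis_vec j \<in> \<delta> (Suc q) ` free_module (rk (Suc (Suc q)))" using exact_Suc b by simp
    then show False using basis_vec_notin_image[of _ "Suc q" j] by (metis imageE)
  qed
  moreover have "vec_homogeneous (deg q) (deg (Suc q) j) (\<delta> q (basis_vec j))"
    by (rule graded_differential[OF b vec_homogeneous_basis_vec])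
  moreover have "?Z \<subseteq> vec_order (deg q) (int (e + (q + 1)))"
    by (rule submodule_generated_in_degree_ge[OF syzygies_linear])
  ultimately show ?thesis
    using vec_homogeneous_order_eq_0 b Suc by (metis image_subset_iff linorder_not_le Suc_eq_plus1)
qed

lemma free_module_order: "(free_module (rk i) :: ('n, 'k) mvec set) \<subseteq> vec_order (deg i) (int (e + i))"
proof
  fix v :: "('n, 'k) mvec" assume v: "v \<in> free_module (rk i)"
  show "v \<in> vec_order (deg i) (int (e + i))"
    unfolding vec_order_def
  proof (rule CollectI, rule allI)
    fix j
    show "lookup v j \<in> mon_ideal {m. int (e + i) \<le> int (mdegree m) + deg i j}"
    proof (cases "j < rk i")
      case True
      then show ?thesis using deg_ge[OF True] by (auto simp: mon_ideal_def)
    next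
      case False
      then show ?thesis using v by (simp add: free_module_iff mon_ideal_def)
    qed
  qed
qed

section \<open>Lifting elements of high order along the resolution\<close>

lemma \<epsilon>_diff: "\<epsilon> (u - v) = \<epsilon> u - \<epsilon> v"
  and \<epsilon>_scale: "\<epsilon> (vec_scale c v) = c * \<epsilon> v"
  using linear_augmentation module_hom.diff module_hom.scale by blast+

lemma \<delta>_diff: "\<delta> i (u - v) = \<delta> i u - \<delta> i v"
  and \<delta>_scale: "\<delta> i (vec_scale c v) = vec_scale c (\<delta> i v)"
  using linear_differential module_hom.diff module_hom.scale by blast+

text \<open>The maximal ideal times \<open>F_i\<close>, written as sums over the variables so that
  it can be matched with \<open>koszul.ispan\<close>.\<close>

definition max_times :: "nat \<Rightarrow> ('n, 'k) mvec set" where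
  "max_times i = {\<Sum>j\<in>UNIV. vec_scale (var j) (w j) | w. range w \<subseteq> free_module (rk i)}"

lemma max_timesI: "range w \<subseteq> free_module (rk i) \<Longrightarrow> (\<Sum>j\<in>UNIV. vec_scale (var j) (w j)) \<in> max_times i"
  unfolding max_times_def by blast

lemma max_times_order: "max_times i \<subseteq> vec_order (deg i) (int (e + i) + 1)"
  unfolding max_times_def using free_module_order[of i]
  by (auto intro!: vec_module.subspace_sum[OF subspace_vec_order] vec_scale_var_order)

lemma max_times_in_free_module: "max_times i \<subseteq> free_module (rk i)"
  unfolding max_times_def
  by (auto intro!: vec_module.subspace_sum[OF subspace_free_module] vec_module.subspace_scale[OF subspace_free_module])

text \<open>The syzygies in \<open>F_i\<close> are generated in degree \<open>e + i + 1\<close>, so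
  order \<open>e + i + 2\<close> makes \<open>z\<close> a combination of syzygies with variables as
  coefficients, and the syzygies are lifted one by one. The bound is what the chase provides:
  elements of \<open>max_times i\<close> have order \<open>e + i + 1\<close>, and the Koszul
  differential adds one.\<close>

lemma lift_max_times:
  assumes "z \<in> \<delta> i ` free_module (rk (Suc i))" "z \<in> vec_order (deg i) (int (e + i) + 2)"
  shows "\<exists>w\<in>max_times (Suc i). \<delta> i w = z"
proof -
  have "z \<in> vec_order (deg i) (int (e + (i + 1)) + 1)" using assms(2) by (simp add: algebra_simps)
  then obtain u where u: "range u \<subseteq> \<delta> i ` free_module (rk (Suc i))" "z = (\<Sum>j\<in>UNIV. vec_scale (var j) (u j))"
    using submodule_nakayama[OF syzygies_linear assms(1)] by blast
  then have "\<forall>j. \<exists>w\<in>free_module (rk (Suc i)). u j = \<delta> i w" by blast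
  then obtain w where w: "\<And>j. w j \<in> free_module (rk (Suc i))" "\<And>j. u j = \<delta> i (w j)" by metis
  have "\<delta> i (\<Sum>j\<in>UNIV. vec_scale (var j) (w j)) = z"
    by (simp add: module_hom.sum[OF linear_differential] \<delta>_scale u w)
  then show ?thesis using w by (blast intro: max_timesI)
qed

lemma lift_max_times_augmentation:
  assumes "z \<in> I" "z \<in> mon_ideal {m. e + 1 \<le> mdegree m}"
  shows "\<exists>w\<in>max_times 0. \<epsilon> w = z"
proof -
  obtain u where u: "range u \<subseteq> I" "z = (\<Sum>j\<in>UNIV. var j * u j)"
    using ideal_nakayama[OF ideal_linear assms] by blast
  then have "\<forall>j. \<exists>w\<in>free_module (rk 0). u j = \<epsilon> w" using exact_ideal by blast
  then obtain w where w: "\<And>j. w j \<in> free_module (rk 0)" "\<And>j. u j = \<epsilon> (w j)" by metis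
  have "\<epsilon> (\<Sum>j\<in>UNIV. vec_scale (var j) (w j)) = z"
    by (simp add: module_hom.sum[OF linear_augmentation] \<epsilon>_scale u w)
  then show ?thesis using w by (blast intro: max_timesI)
qed

lemma \<epsilon>_\<delta>: "v \<in> free_module (rk 1) \<Longrightarrow> \<epsilon> (\<delta> 0 v) = 0"
  using exact_0 by blast

lemma \<delta>_in: "v \<in> free_module (rk (Suc i)) \<Longrightarrow> \<delta> i v \<in> free_module (rk i)"
proof (cases i)
  case 0
  assume "v \<in> free_module (rk (Suc i))"
  then have "\<delta> i v \<in> \<delta> 0 ` free_module (rk 1)" using 0 by simp
  then show ?thesis unfolding exact_0 using 0 by simp
next
  case (Suc q)
  assume "v \<in> free_module (rk (Suc i))"
  then have "\<delta> i v \<in> \<delta> (Suc q) ` free_module (rk (Suc (Suc q)))" using Suc by simp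
  then show ?thesis unfolding exact_Suc using Suc by simp
qed

lemma \<delta>_\<delta>: "v \<in> free_module (rk (Suc (Suc i))) \<Longrightarrow> \<delta> i (\<delta> (Suc i) v) = 0"
  using exact_Suc by blast

lemma zero_in_max_times: "0 \<in> max_times i"
  using max_timesI[of "\<lambda>_. 0" i] by (simp add: free_module_iff subset_iff)

text \<open>
  Suppose that all \<open>x\<^sub>i f\<close> lie in \<open>I\<close>. The elements \<open>x\<^sub>i f\<close> are lifted along the resolution to cochains
  \<open>G q\<close> of cardinality \<open>q + 1\<close> with values in \<open>F\<^sub>q\<close>. Linearity keeps their values in \<open>\<mm> F\<^sub>q\<close>, so
  that the one of cardinality \<open>n\<close> is a coboundary. Going back down, exactness of the Koszul complex
  replaces each \<open>G q\<close> by a coboundary, up to the image of \<open>\<delta> q\<close>; for \<open>q = 0\<close> this yields \<open>f \<in> I\<close>.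
\<close>

lemma socle_degree:
  assumes f: "\<And>i. var i * f \<in> I" "f \<in> mon_ideal {m. e \<le> mdegree m}"
  shows "f \<in> I"
proof -
  define n where "n = card (UNIV :: 'n set)"
  have n: "n > 0" by (simp add: n_def finite_UNIV_card_ge_0)
  obtain x :: "nat \<Rightarrow> 'n" where x: "bij_betw x {..<n} UNIV"
    using ex_bij_betw_nat_finite[of "UNIV :: 'n set"] by (auto simp: n_def atLeast0LessThan)
  define X where "X = (\<lambda>i. vec_scale (var (x i) :: ('n, 'k) mpoly))"
  define Y where "Y = (\<lambda>i. (*) (var (x i) :: ('n, 'k) mpoly))"
  have kos: "koszul X (\<lambda>i. vec_quo (x i)) n (free_module (rk q))" for q
    unfolding X_def using x by (intro koszul_free_module) (simp add: bij_betw_def)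
  have X_diff: "X i (u - v) = X i u - X i v" and X_comm: "X i (X j v) = X j (X i v)" for i j u v
    using koszul.X_diff[OF kos] koszul.X_comm[OF kos] by auto
  have X_0: "X i 0 = 0" for i by (simp add: X_def)
  have Y_diff: "Y i (u - v) = Y i u - Y i v" and Y_comm: "Y i (Y j v) = Y j (Y i v)" for i j u v
    by (simp_all add: Y_def algebra_simps)
  have kd_\<epsilon>: "\<epsilon> (kd X n g A) = kd Y n (\<lambda>B. \<epsilon> (g B)) A" for g A
    by (rule kd_hom) (simp_all add: \<epsilon>_diff \<epsilon>_scale X_def Y_def)
  have kd_\<delta>: "\<delta> q (kd X n g A) = kd X n (\<lambda>B. \<delta> q (g B)) A" for q g A
    by (rule kd_hom) (simp_all add: \<delta>_diff \<delta>_scale X_def)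
  have ispan_max_times: "max_times q \<subseteq> koszul.ispan X (free_module (rk q)) n" for q
  proof
    fix v assume "v \<in> max_times q"
    then obtain w where w: "range w \<subseteq> free_module (rk q)" "v = (\<Sum>j\<in>UNIV. vec_scale (var j) (w j))"
      by (auto simp: max_times_def)
    have "v = (\<Sum>i<n. X i (w (x i)))"
      unfolding w X_def by (rule sum.reindex_bij_betw[OF x, symmetric])
    moreover have "range (\<lambda>i. w (x i)) \<subseteq> free_module (rk q)" using w by auto
    ultimately show "v \<in> koszul.ispan X (free_module (rk q)) n"
      using koszul.ispanI[OF kos, of "\<lambda>i. w (x i)" q n] by simp
  qed
  have kd_order: "kd X n g A \<in> vec_order d (t + 1)" if "\<And>B. g B \<in> vec_order d t" for g A d t
  proof -
    have "kd X r g A \<in> vec_order d (t + 1)" for r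
      using that
    proof (induction r arbitrary: g A)
      case 0
      then show ?case by (simp add: vec_module.subspace_0[OF subspace_vec_order])
    next
      case (Suc r)
      then show ?case
        by (auto simp: kd.simps(2) X_def intro!: vec_module.subspace_diff[OF subspace_vec_order] vec_scale_var_order)
    qed
    then show ?thesis .
  qed

  \<comment> \<open>Closedness is required only modulo the image of \<open>\<delta> q\<close>: the
    defect is what the next stage lifts.\<close>
  define cocycle where "cocycle = (\<lambda>q g. (\<forall>A. g A \<in> max_times q) \<and>
    (\<forall>A\<subseteq>{..<n}. card A = q + 2 \<longrightarrow> kd X n g A \<in> \<delta> q ` free_module (rk (Suc q))))"
  have cocycle_free: "g A \<in> free_module (rk q)" if "cocycle q g" for q g A
    using that max_times_in_free_module by (auto simp: cocycle_def)
  have "\<exists>g. cocycle 0 g \<and> (\<forall>i<n. \<epsilon> (g {i}) = Y i f)"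
  proof -
    have "\<exists>w\<in>max_times 0. \<epsilon> w = Y i f" for i
    proof (rule lift_max_times_augmentation)
      show "Y i f \<in> mon_ideal {m. e + 1 \<le> mdegree m}"
        using keys_mult[of "var (x i)" f] f(2) by (fastforce simp: Y_def mon_ideal_def var_def)
    qed (simp add: Y_def f)
    then obtain w where w: "\<And>i. w i \<in> max_times 0" "\<And>i. \<epsilon> (w i) = Y i f" by metis
    \<comment> \<open>Only singletons matter. On other sets \<open>the_elem\<close> is arbitrary,
      but every \<open>w i\<close> lies in \<open>max_times 0\<close>.\<close>
    define g where "g = (\<lambda>A. w (the_elem A))"
    have "kd X n g A \<in> \<delta> 0 ` free_module (rk 1)" if A: "A \<subseteq> {..<n}" "card A = 2" for A
    proof -
      have "\<epsilon> (kd X n g A) = kd Y n (\<lambda>B. \<epsilon> (g B)) A" by (rule kd_\<epsilon>)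
      \<comment> \<open>On singletons \<open>\<epsilon>\<close> of \<open>g\<close> is the Koszul
        differential of the constant cochain \<open>f\<close>, which reduces closedness to
        \<open>kd_kd\<close>.\<close>
      also have "\<dots> = kd Y n (kd Y n (\<lambda>_. f)) A"
      proof (rule kd_cong[OF A(1)])
        fix i assume "i \<in> A"
        then have "card (A - {i}) = 1" using A by simp
        then obtain j where j: "A - {i} = {j}" by (rule card_1_singletonE)
        then have "j < n" using A by auto
        then show "\<epsilon> (g (A - {i})) = kd Y n (\<lambda>_. f) (A - {i})"
          by (simp add: j g_def w kd_singleton)
      qed
      also have "\<dots> = 0" by (rule kd_kd[of Y, OF Y_diff Y_comm A(1)])
      finally have "\<epsilon> (kd X n g A) = 0" .
      moreover have "kd X n g A \<in> free_module (rk 0)"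
        using w max_times_in_free_module by (intro koszul.kd_in[OF kos]) (auto simp: g_def)
      ultimately show ?thesis using exact_0 by simp
    qed
    then have "cocycle 0 g" by (simp add: cocycle_def g_def w numeral_2_eq_2)
    then show ?thesis using w by (auto simp: g_def)
  qed
  then obtain g\<^sub>0 where g\<^sub>0: "cocycle 0 g\<^sub>0" "\<And>i. i < n \<Longrightarrow> \<epsilon> (g\<^sub>0 {i}) = Y i f" by blast

  have lift: "\<exists>g'. cocycle (Suc q) g' \<and> (\<forall>A\<subseteq>{..<n}. card A = q + 2 \<longrightarrow> \<delta> q (g' A) = kd X n g A)"
    if g: "cocycle q g" for q g
  proof -
    have "\<exists>w\<in>max_times (Suc q). A \<subseteq> {..<n} \<longrightarrow> card A = q + 2 \<longrightarrow> \<delta> q w = kd X n g A" for A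
    proof (cases "A \<subseteq> {..<n} \<and> card A = q + 2")
      case True
      have "\<And>B. g B \<in> vec_order (deg q) (int (e + q) + 1)"
        using g max_times_order by (auto simp: cocycle_def)
      then have "kd X n g A \<in> vec_order (deg q) (int (e + q) + 1 + 1)" by (rule kd_order)
      moreover have "kd X n g A \<in> \<delta> q ` free_module (rk (Suc q))"
        using g True by (simp add: cocycle_def)
      ultimately show ?thesis using lift_max_times[of "kd X n g A" q] by (auto simp: add.assoc)
    qed (use zero_in_max_times in blast)
    then obtain g' where g': "\<And>A. g' A \<in> max_times (Suc q)"
        "\<And>A. A \<subseteq> {..<n} \<Longrightarrow> card A = q + 2 \<Longrightarrow> \<delta> q (g' A) = kd X n g A"
      by metis
    have "kd X n g' A \<in> \<delta> (Suc q) ` free_module (rk (Suc (Suc q)))"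
      if A: "A \<subseteq> {..<n}" "card A = Suc q + 2" for A
    proof -
      have "\<delta> q (kd X n g' A) = kd X n (\<lambda>B. \<delta> q (g' B)) A" by (rule kd_\<delta>)
      also have "\<dots> = kd X n (kd X n g) A"
      proof (rule kd_cong[OF A(1)])
        fix i assume "i \<in> A"
        then have "A - {i} \<subseteq> {..<n}" "card (A - {i}) = q + 2" using A by auto
        then show "\<delta> q (g' (A - {i})) = kd X n g (A - {i})" by (rule g'(2))
      qed
      also have "\<dots> = 0" by (rule kd_kd[of X, OF X_diff X_comm A(1)])
      finally have "\<delta> q (kd X n g' A) = 0" .
      moreover have "kd X n g' A \<in> free_module (rk (Suc q))"
        using g' max_times_in_free_module by (intro koszul.kd_in[OF kos]) auto
      ultimately show ?thesis using exact_Suc[of q] by simp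
    qed
    then show ?thesis using g' by (intro exI[of _ g']) (auto simp: cocycle_def)
  qed
  define R where "R = (\<lambda>q g g'. \<forall>A\<subseteq>{..<n}. card A = q + 2 \<longrightarrow> \<delta> q (g' A) = kd X n g A)"
  have "\<exists>G. \<forall>q. (cocycle q (G q) \<and> (q = 0 \<longrightarrow> G q = g\<^sub>0)) \<and> R q (G q) (G (Suc q))"
    by (rule dependent_nat_choice) (use g\<^sub>0 lift in \<open>auto simp: R_def\<close>)
  then obtain G where G: "\<And>q. cocycle q (G q)" "G 0 = g\<^sub>0"
      "\<And>q A. A \<subseteq> {..<n} \<Longrightarrow> card A = q + 2 \<Longrightarrow> \<delta> q (G (Suc q) A) = kd X n (G q) A"
    unfolding R_def by metis

  have exact: "\<exists>h. (\<forall>A. h A \<in> free_module (rk q)) \<and> (\<forall>A\<subseteq>{..<n}. card A = q + 1 \<longrightarrow> g A = kd X n h A)"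
    if g: "\<And>A. g A \<in> free_module (rk q)" "q < n"
      "\<And>A. A \<subseteq> {..<n} \<Longrightarrow> card A = q + 2 \<Longrightarrow> kd X n g A = 0"
      "q + 1 = n \<Longrightarrow> g {..<n} \<in> max_times q" for q g
  proof -
    \<comment> \<open>\<open>koszul_exact\<close> asks for a cocycle in all cardinalities at once,
      so \<open>g\<close> is cut down to the one that counts.\<close>
    define g' where "g' = (\<lambda>A. if card A = q + 1 then g A else 0)"
    have "\<exists>h. (\<forall>A. h A \<in> free_module (rk q)) \<and> (\<forall>A\<subseteq>{..<n}. kd X n h A = g' A)"
    proof (rule koszul.koszul_exact[OF kos order_refl])
      show "g' A \<in> free_module (rk q)" for A
        using g by (simp add: g'_def free_module_iff)
      show "kd X n g' A = 0" if A: "A \<subseteq> {..<n}" for A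
      proof (cases "card A = q + 2")
        case True
        have "kd X n g' A = kd X n g A"
          by (rule kd_cong[OF A]) (use True in \<open>simp add: g'_def\<close>)
        then show ?thesis using g True A by simp
      next
        case False
        have "kd X n g' A = kd X n (\<lambda>_. 0) A"
        proof (rule kd_cong[OF A])
          fix i assume i: "i \<in> A"
          have "finite A" using A finite_subset by blast
          then have "card A = Suc (card (A - {i}))" using i by (metis card_Suc_Diff1)
          then show "g' (A - {i}) = 0" using False by (simp add: g'_def)
        qed
        then show ?thesis by (simp add: kd_zero[of X, OF X_0])
      qed
      show "g' {..<n} \<in> koszul.ispan X (free_module (rk q)) n"
        using g(4) ispan_max_times koszul.ispan_0[OF kos] by (auto simp: g'_def)
    qed
    then obtain h where "\<And>A. h A \<in> free_module (rk q)" "\<And>A. A \<subseteq> {..<n} \<Longrightarrow> kd X n h A = g' A"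
      by blast
    then show ?thesis by (intro exI[of _ h]) (simp add: g'_def)
  qed

  have "\<exists>h k. (\<forall>A. h A \<in> free_module (rk q)) \<and>
      (\<forall>A\<subseteq>{..<n}. card A = q + 1 \<longrightarrow> k A \<in> free_module (rk (Suc q)) \<and> G q A = kd X n h A + \<delta> q (k A))"
    if "q < n" for q
    using that
  proof (induction "n - Suc q" arbitrary: q)
    case 0
    then have q: "q + 1 = n" by simp
    \<comment> \<open>No subset of \<open>{..<n}\<close> has \<open>n + 1\<close> elements, so the
      last cochain is closed. This is also the only stage at which the top condition of
      \<open>exact\<close> has content; it is met by \<open>max_times\<close>, and so by
      linearity.\<close>
    have "kd X n (G q) A = 0" if "A \<subseteq> {..<n}" "card A = q + 2" for A
      using card_mono[OF _ that(1)] that q by simp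
    then have "\<exists>h. (\<forall>A. h A \<in> free_module (rk q)) \<and> (\<forall>A\<subseteq>{..<n}. card A = q + 1 \<longrightarrow> G q A = kd X n h A)"
      using G(1)[of q] q by (intro exact cocycle_free) (auto simp: cocycle_def)
    moreover have "\<delta> q 0 = 0" using \<delta>_diff[of q 0 0] by simp
    ultimately show ?case
      by (elim exE, intro exI[of _ "\<lambda>_. 0"] exI) (auto simp: free_module_iff)
  next
    case (Suc p)
    then have "p = n - Suc (Suc q)" "Suc q < n" by auto
    from Suc.hyps(1)[OF this] obtain h k where hk: "\<And>A. h A \<in> free_module (rk (Suc q))"
        "\<And>A. A \<subseteq> {..<n} \<Longrightarrow> card A = Suc q + 1 \<Longrightarrow> k A \<in> free_module (rk (Suc (Suc q))) \<and>
          G (Suc q) A = kd X n h A + \<delta> (Suc q) (k A)"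
      by blast
    \<comment> \<open>Subtracting the image of the primitive found one stage higher turns closedness
      modulo the image of \<open>\<delta> q\<close> into closedness: the term with \<open>k\<close>
      dies under two consecutive differentials.\<close>
    define g where "g = (\<lambda>A. G q A - \<delta> q (h A))"
    have "\<exists>h'. (\<forall>A. h' A \<in> free_module (rk q)) \<and> (\<forall>A\<subseteq>{..<n}. card A = q + 1 \<longrightarrow> g A = kd X n h' A)"
    proof (rule exact)
      show "g A \<in> free_module (rk q)" for A
        unfolding g_def using G(1) cocycle_free \<delta>_in hk(1)
        by (intro vec_module.subspace_diff[OF subspace_free_module]) auto
      fix A assume A: "A \<subseteq> {..<n}" "card A = q + 2"
      have "\<delta> q (G (Suc q) A) = \<delta> q (kd X n h A)"
        using hk(2)[OF A(1)] A(2) \<delta>_\<delta> module_hom.add[OF linear_differential] by simp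
      then have "kd X n (G q) A = kd X n (\<lambda>B. \<delta> q (h B)) A"
        using G(3)[OF A] kd_\<delta> by simp
      then show "kd X n g A = 0"
        unfolding g_def kd_diff[of X, OF X_diff] by simp
    qed (use Suc in auto)
    then obtain h' where h': "\<And>A. h' A \<in> free_module (rk q)"
        "\<And>A. A \<subseteq> {..<n} \<Longrightarrow> card A = q + 1 \<Longrightarrow> g A = kd X n h' A"
      by blast
    have "G q A = kd X n h' A + \<delta> q (h A)" if "A \<subseteq> {..<n}" "card A = q + 1" for A
      using h'(2)[OF that] by (simp add: g_def algebra_simps)
    then show ?case using h' hk(1) by (intro exI[of _ h'] exI[of _ h]) auto
  qed
  from this[OF n] obtain h k where hk: "\<And>A. h A \<in> free_module (rk 0)"
      "\<And>A. A \<subseteq> {..<n} \<Longrightarrow> card A = 1 \<Longrightarrow> k A \<in> free_module (rk 1) \<and> g\<^sub>0 A = kd X n h A + \<delta> 0 (k A)"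
    unfolding G(2) by auto
  \<comment> \<open>One variable suffices: the augmentation kills the \<open>\<delta> 0\<close>
    term, and a common factor of the remaining equation can be cancelled.\<close>
  have "Y 0 f = \<epsilon> (g\<^sub>0 {0})" using g\<^sub>0(2) n by simp
  also have "\<dots> = \<epsilon> (X 0 (h {}))"
    using hk(2)[of "{0}"] n \<epsilon>_\<delta> module_hom.add[OF linear_augmentation] by (simp add: kd_singleton)
  also have "\<dots> = Y 0 (\<epsilon> (h {}))" by (simp add: X_def Y_def \<epsilon>_scale)
  finally have "f = \<epsilon> (h {})"
    unfolding Y_def by (metis quo_var_same)
  then show "f \<in> I" using exact_ideal hk(1) by blast
qed

end

lemma linear_resolution_socle:
  assumes "linear_resolution e J"
    and "\<And>i. var i * f \<in> J" "f \<in> mon_ideal {m. e \<le> mdegree m}"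
  shows "f \<in> J"
proof -
  obtain rk deg \<epsilon> \<delta> where "ideal_generated_in_degree (int e) J"
      "minimal_graded_free_resolution J rk deg \<epsilon> \<delta>"
      "\<forall>i. submodule_generated_in_degree (deg i) (int (e + (i + 1))) (\<delta> i ` free_module (rk (Suc i)))"
    using assms(1) unfolding linear_resolution_def by blast
  then have "linear_free_resolution J rk deg \<epsilon> \<delta> e"
    by (simp add: linear_free_resolution_def linear_free_resolution_axioms_def)
  then show ?thesis using assms(2,3) by (rule linear_free_resolution.socle_degree)
qed

section \<open>The saturation number of a monomial ideal with linear resolution\<close>

definition saturation :: "('n::finite \<Rightarrow>\<^sub>0 nat) set \<Rightarrow> ('n \<Rightarrow>\<^sub>0 nat) set" where
  "saturation E = {m. \<exists>N. \<forall>v. mdegree v \<ge> N \<longrightarrow> m + v \<in> E}"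

lemma subset_saturation: "upclosed E \<Longrightarrow> E \<subseteq> saturation E"
  by (auto simp: saturation_def upclosed_def)

lemma upclosed_saturation:
  assumes "upclosed E"
  shows "upclosed (saturation E)"
  unfolding upclosed_def
proof (intro ballI allI)
  fix m v assume "m \<in> saturation E"
  then obtain N where N: "\<And>w. mdegree w \<ge> N \<Longrightarrow> m + w \<in> E" by (auto simp: saturation_def)
  have "m + v + w \<in> E" if "mdegree w \<ge> N" for w
    using N[of "v + w"] that by (simp add: add.assoc)
  then show "m + v \<in> saturation E" by (auto simp: saturation_def)
qed

text \<open>All that the computation of the saturation number retains of a linear resolution: no
  elements below degree \<open>e\<close>, and no socle of the quotient from degree \<open>e\<close>
  on.\<close>

locale linear_exponents =
  fixes E :: "('n::finite \<Rightarrow>\<^sub>0 nat) set" and e :: nat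
  assumes up: "upclosed E"
    and degree_ge: "m \<in> E \<Longrightarrow> e \<le> mdegree m"
    and socle: "e \<le> mdegree m \<Longrightarrow> (\<And>i. Poly_Mapping.single i 1 + m \<in> E) \<Longrightarrow> m \<in> E"
begin

text \<open>Induction on a power of the maximal ideal that multiplies \<open>m\<close> into the
  ideal: the multiples of \<open>m\<close> by variables need one power less, and the socle condition
  brings membership back to \<open>m\<close>.\<close>

lemma saturation_degree_ge:
  assumes "m \<in> saturation E" "e \<le> mdegree m"
  shows "m \<in> E"
proof -
  obtain N where "\<And>v. mdegree v \<ge> N \<Longrightarrow> m + v \<in> E" using assms by (auto simp: saturation_def)
  then show ?thesis
    using assms(2)
  proof (induction N arbitrary: m)
    case 0
    then show ?case using "0.prems"(1)[of 0] by simp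
  next
    case (Suc N)
    have "\<And>i. Poly_Mapping.single i 1 + m \<in> E"
    proof (rule Suc.IH)
      fix i and v :: "'n \<Rightarrow>\<^sub>0 nat" assume "N \<le> mdegree v"
      then have "m + (Poly_Mapping.single i 1 + v) \<in> E" by (intro Suc.prems) simp
      then show "Poly_Mapping.single i 1 + m + v \<in> E" by (simp add: ac_simps)
    qed (use Suc.prems in simp)
    then show ?case by (rule socle[OF Suc.prems(2)])
  qed
qed

text \<open>From \<open>k = e - mdegree u\<close> on, every product of an element of the saturation
  with a monomial of degree \<open>k\<close> reaches degree \<open>e\<close>, where saturation and
  ideal agree. For smaller \<open>k\<close> the colons still grow.\<close>

lemma sat_eq:
  assumes u: "u \<in> saturation E" "mdegree u \<le> e"
    and min: "\<And>m. m \<in> saturation E \<Longrightarrow> mdegree u \<le> mdegree m"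
  shows "sat (mon_ideal E :: ('n, 'k::field) mpoly set) = e - mdegree u"
  unfolding sat_mon_ideal[OF up]
proof (rule Least_equality)
  let ?C = "\<lambda>k. {m. \<forall>v. k \<le> mdegree v \<longrightarrow> m + v \<in> E}"
  have colon: "?C k = saturation E" if "e - mdegree u \<le> k" for k
  proof (intro equalityI subsetI)
    fix m assume m: "m \<in> saturation E"
    have "m + v \<in> E" if "k \<le> mdegree v" for v
    proof (rule saturation_degree_ge)
      show "m + v \<in> saturation E" using m by (rule upclosedD[OF upclosed_saturation[OF up]])
      show "e \<le> mdegree (m + v)" using min[OF m] that \<open>e - mdegree u \<le> k\<close> by simp
    qed
    then show "m \<in> ?C k" by simp
  qed (auto simp: saturation_def)
  show "?C (e - mdegree u + 1) = ?C (e - mdegree u)" by (simp add: colon)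
  fix k assume k: "?C (k + 1) = ?C k"
  show "e - mdegree u \<le> k"
  proof (rule ccontr)
    assume "\<not> e - mdegree u \<le> k"
    then have less: "mdegree u + k < e" by linarith
    fix i :: 'n
    \<comment> \<open>The exponent is chosen to give \<open>w\<close> degree
      \<open>e - 1 - k\<close>. Degree \<open>k + 1\<close> more reaches \<open>e\<close>, where the
      saturation lies in \<open>E\<close>; degree \<open>k\<close> more stops at
      \<open>e - 1\<close>, where \<open>E\<close> has no elements.\<close>
    define w where "w = u + Poly_Mapping.single i (e - 1 - k - mdegree u)"
    have w: "w \<in> saturation E" unfolding w_def by (rule upclosedD[OF upclosed_saturation[OF up] u(1)])
    have deg_w: "mdegree w + k + 1 = e" using less by (simp add: w_def)
    have "w + v \<in> E" if "k + 1 \<le> mdegree v" for v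
      using upclosedD[OF upclosed_saturation[OF up] w] deg_w that by (intro saturation_degree_ge) auto
    then have "w \<in> ?C k" unfolding k[symmetric] by simp
    then have "w + Poly_Mapping.single i k \<in> E" by simp
    then show False using degree_ge deg_w by fastforce
  qed
qed

end

section \<open>Minimal ratios in subtractive monoids\<close>

lemma incseq_subseq_nat:
  fixes s :: "nat \<Rightarrow> nat"
  shows "\<exists>r :: nat \<Rightarrow> nat. strict_mono r \<and> mono (\<lambda>n. s (r n))"
proof -
  obtain r :: "nat \<Rightarrow> nat" where r: "strict_mono r" "monoseq (\<lambda>n. s (r n))"
    using seq_monosub by blast
  show ?thesis
  proof (cases "mono (\<lambda>n. s (r n))")
    case False
    then have dec: "\<And>m n. m \<le> n \<Longrightarrow> s (r n) \<le> s (r m)"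
      using r(2) by (auto simp: monoseq_def mono_def)
    obtain N where N: "\<And>n. s (r N) \<le> s (r n)"
      using ex_has_least_nat[of "\<lambda>_. True" 0 "\<lambda>n. s (r n)"] by blast
    have "s (r (N + n)) = s (r N)" for n
      using N[of "N + n"] dec[of N "N + n"] by simp
    moreover have "strict_mono (\<lambda>n. r (N + n))" using r(1) by (simp add: strict_mono_def)
    ultimately show ?thesis by (intro exI[of _ "\<lambda>n. r (N + n)"]) (simp add: mono_def)
  qed (use r in blast)
qed

lemma dickson:
  fixes \<Phi> :: "('a \<Rightarrow> nat) set" and f :: "nat \<Rightarrow> 'a"
  assumes "finite \<Phi>"
  shows "\<exists>r :: nat \<Rightarrow> nat. strict_mono r \<and> (\<forall>\<phi>\<in>\<Phi>. mono (\<lambda>n. \<phi> (f (r n))))"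
  using assms
proof (induction \<Phi> rule: finite_induct)
  case empty
  show ?case by (intro exI[of _ id]) (simp add: strict_mono_def)
next
  case (insert \<phi> \<Phi>)
  then obtain r :: "nat \<Rightarrow> nat" where r: "strict_mono r" "\<And>\<psi>. \<psi> \<in> \<Phi> \<Longrightarrow> mono (\<lambda>n. \<psi> (f (r n)))" by blast
  obtain t :: "nat \<Rightarrow> nat" where t: "strict_mono t" "mono (\<lambda>n. \<phi> (f (r (t n))))"
    using incseq_subseq_nat[of "\<lambda>n. \<phi> (f (r n))"] by blast
  have "mono (\<lambda>n. \<psi> (f (r (t n))))" if "\<psi> \<in> \<Phi>" for \<psi>
    using r(2)[OF that] strict_mono_mono[OF t(1)] by (simp add: mono_def)
  then show ?case
    using r(1) t by (intro exI[of _ "\<lambda>n. r (t n)"]) (auto simp: strict_mono_def)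
qed

text \<open>If no ratio \<open>L / K\<close> were least, there would be a sequence of strictly
  decreasing ratios, each term having the smallest \<open>K\<close> among all elements whose ratio
  is below that of its predecessor. Dickson's lemma finds \<open>z\<close> before \<open>z'\<close>
  in it, comparable in every coordinate. The difference \<open>w\<close> then has a ratio below that
  of the predecessor of \<open>z'\<close> but a smaller \<open>K\<close> than \<open>z'\<close>,
  against the choice of \<open>z'\<close>.\<close>

lemma min_ratio_attained:
  fixes T :: "'a set" and L K :: "'a \<Rightarrow> nat" and \<Phi> :: "('a \<Rightarrow> nat) set"
  assumes "finite \<Phi>"
    and sub: "\<And>z z'. z \<in> T \<Longrightarrow> z' \<in> T \<Longrightarrow> (\<And>\<phi>. \<phi> \<in> \<Phi> \<Longrightarrow> \<phi> z \<le> \<phi> z') \<Longrightarrow>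
      \<exists>w\<in>T. L z' = L z + L w \<and> K z' = K z + K w"
    and "\<exists>z\<in>T. K z > 0"
  shows "\<exists>z\<in>T. K z > 0 \<and> (\<forall>w\<in>T. L z * K w \<le> L w * K z)"
proof (rule ccontr)
  define lt where "lt = (\<lambda>w z. L w * K z < L z * K w)"
  define P where "P = (\<lambda>z. z \<in> T \<and> K z > 0)"
  have lt_trans: "lt x z" if "lt x y" "lt y z" "K y > 0" for x y z
  proof -
    have "K x > 0" using that(1) by (auto simp: lt_def intro: gr0I)
    have "(L x * K z) * K y \<le> (L y * K z) * K x"
      using mult_right_mono[of "L x * K y" "L y * K x" "K z"] that(1) by (simp add: lt_def ac_simps)
    also have "\<dots> < (L z * K x) * K y"
      using that(2) \<open>K x > 0\<close> mult_strict_right_mono[of "L y * K z" "L z * K y" "K x"]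
      by (simp add: lt_def ac_simps)
    finally show ?thesis using that(3) by (simp add: lt_def)
  qed
  assume "\<not> ?thesis"
  then have lower: "\<exists>w. P w \<and> lt w z" if "P z" for z
    using that by (force simp: P_def lt_def not_le intro: gr0I)
  define Q where "Q = (\<lambda>z w. lt w z \<and> (\<forall>y\<in>T. lt y z \<longrightarrow> K w \<le> K y))"
  have "\<exists>F. \<forall>n. P (F n) \<and> Q (F n) (F (Suc n))"
  proof (rule dependent_nat_choice)
    show "\<exists>z. P z" using assms(3) by (auto simp: P_def)
    fix z and n :: nat assume "P z"
    then obtain w where "P w \<and> lt w z" using lower by blast
    from ex_has_least_nat[of "\<lambda>w. P w \<and> lt w z", OF this, of K]
    obtain w where "P w" "lt w z" "\<forall>y. P y \<and> lt y z \<longrightarrow> K w \<le> K y" by blast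
    moreover have "P y" if "y \<in> T" "lt y z" for y
      using that by (auto simp: P_def lt_def intro: gr0I)
    ultimately show "\<exists>w. P w \<and> Q z w" by (auto simp: Q_def)
  qed
  then obtain F where F: "\<And>n. P (F n)" "\<And>n. Q (F n) (F (Suc n))" by blast
  have dec: "lt (F j) (F i)" if "i < j" for i j
    using that
  proof (induction j)
    case (Suc j)
    have "lt (F (Suc j)) (F j)" using F(2)[of j] by (simp add: Q_def)
    then show ?case using Suc lt_trans F(1) by (cases "i = j") (auto simp: P_def)
  qed simp
  obtain r :: "nat \<Rightarrow> nat" where r: "strict_mono r" "\<And>\<phi>. \<phi> \<in> \<Phi> \<Longrightarrow> mono (\<lambda>n. \<phi> (F (r n)))"
    using dickson[OF assms(1)] by blast
  let ?z = "F (r 0)" and ?z' = "F (r 1)"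
  have "r 0 < r 1" using r(1) by (simp add: strict_mono_def)
  then obtain j where j: "r 1 = Suc j" by (cases "r 1") auto
  have "\<phi> ?z \<le> \<phi> ?z'" if "\<phi> \<in> \<Phi>" for \<phi>
    using r(2)[OF that] by (auto simp: mono_def)
  then obtain w where w: "w \<in> T" "L ?z' = L ?z + L w" "K ?z' = K ?z + K w"
    using sub[of ?z ?z'] F(1) by (auto simp: P_def)
  have "lt ?z' ?z" using dec \<open>r 0 < r 1\<close> by blast
  \<comment> \<open>The ratio of \<open>z'\<close> is the mediant of those of \<open>z\<close> and
    \<open>w\<close>; as it is below that of \<open>z\<close>, the ratio of \<open>w\<close> is
    lower still.\<close>
  then have "lt w ?z'" unfolding lt_def w by (simp add: algebra_simps)
  moreover have "lt ?z' (F j)" using F(2)[of j] j by (simp add: Q_def)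
  ultimately have "lt w (F j)" using lt_trans F(1) by (auto simp: P_def)
  then have "K ?z' \<le> K w" using F(2)[of j] j w(1) by (simp add: Q_def)
  moreover have "K ?z > 0" using F(1) by (simp add: P_def)
  ultimately show False using w by simp
qed

section \<open>Quasi-linearity\<close>

lemma nonincreasing_eventually_const:
  fixes t :: "nat \<Rightarrow> int"
  assumes "\<And>m. t (Suc m) \<le> t m" "\<And>m. 0 \<le> t m"
  shows "\<exists>N c. \<forall>m\<ge>N. t m = c"
proof -
  obtain N where N: "\<And>n. nat (t N) \<le> nat (t n)"
    using ex_has_least_nat[of "\<lambda>_. True" 0 "\<lambda>n. nat (t n)"] by blast
  have "t m = t N" if "m \<ge> N" for m
    using lift_Suc_antimono_le[of t, OF assms(1) that] N[of m] assms(2) by (smt (verit) nat_le_eq_zle)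
  then show ?thesis by blast
qed

lemma quasi_linear_of_step:
  fixes s :: "nat \<Rightarrow> nat" and a d :: nat and D :: int
  assumes d: "d \<ge> 1"
    and step: "\<And>k. k \<ge> 1 \<Longrightarrow> s (k + d) \<le> s k + a"
    and lower: "\<And>k. k \<ge> 1 \<Longrightarrow> a * k \<le> d * s k"
  shows "\<exists>f. quasi_linear f \<and> (\<exists>k\<^sub>0::nat. \<forall>k\<ge>k\<^sub>0. f (int k) = D * int k - int (s k))"
proof -
  \<comment> \<open>\<open>Suc m\<close> instead of \<open>m\<close> keeps the argument positive for
    \<open>i = 0\<close> too, as \<open>step\<close> and \<open>lower\<close> start at 1.\<close>
  define t where "t = (\<lambda>i m. int d * int (s (i + Suc m * d)) - int a * int (i + Suc m * d))"
  have "\<exists>N c. \<forall>m\<ge>N. t i m = c" for i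
  proof (rule nonincreasing_eventually_const)
    fix m
    have k: "i + Suc m * d \<ge> 1" using d by simp
    have "int d * int (s (i + Suc m * d + d)) \<le> int d * (int (s (i + Suc m * d)) + int a)"
      using step[OF k] by (intro mult_left_mono) linarith+
    moreover have "i + Suc (Suc m) * d = i + Suc m * d + d" by simp
    ultimately show "t i (Suc m) \<le> t i m"
      unfolding t_def by (simp add: algebra_simps)
    show "0 \<le> t i m"
      using lower[OF k] unfolding t_def by (metis diff_ge_0_iff_ge of_nat_le_iff of_nat_mult)
  qed
  then obtain N c where Nc: "\<And>i m. m \<ge> N i \<Longrightarrow> t i m = c i" by metis
  define M where "M = (\<Sum>i<d. N i)"
  have eventual: "int d * int (s k) = int a * int k + c (k mod d)" if k: "k \<ge> Suc M * d" for k
  proof -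
    have "Suc M \<le> k div d" using k d by (simp add: less_eq_div_iff_mult_less_eq)
    then obtain m where m: "k div d = Suc m" "M \<le> m" by (cases "k div d") auto
    have "N (k mod d) \<le> M" unfolding M_def using d by (intro member_le_sum) auto
    then have "t (k mod d) m = c (k mod d)" using m by (intro Nc) simp
    moreover have "k mod d + Suc m * d = k" unfolding m(1)[symmetric] by simp
    then have "t (k mod d) m = int d * int (s k) - int a * int k" by (simp only: t_def)
    ultimately show ?thesis by simp
  qed
  \<comment> \<open>Solving the eventual formula for \<open>s\<close> gives a function on all
    integers; the division turns out to be exact.\<close>
  define f where "f = (\<lambda>K. D * K - (int a * K + c (nat (K mod int d))) div int d)"
  have f: "of_int (f K) = (of_int D - of_nat a / of_nat d) * of_int K + (- of_int (c i) / of_nat d :: rat)"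
    if i: "i < d" "[K = int i] (mod int d)" for i K
  proof -
    \<comment> \<open>A representative of the residue class within the range of
      \<open>eventual\<close>, where divisibility by \<open>d\<close> is known. It carries over to
      every \<open>K\<close> in the class, negative ones included.\<close>
    let ?k = "i + Suc M * d"
    have Ki: "K mod int d = int i" using i by (simp add: cong_def)
    have "?k mod d = i" using i by (simp del: mult_Suc)
    then have v: "int d * int (s ?k) = int a * int ?k + c i" using eventual[of ?k] by simp
    have "K - int ?k = (K - int i) - int d * int (Suc M)" by (simp add: algebra_simps)
    then have "int d dvd K - int ?k"
      using i(2) unfolding cong_iff_dvd_diff by (metis dvd_diff dvd_triv_left)
    then obtain y where y: "K = int ?k + int d * y" by (metis dvdE diff_add_cancel add.commute)
    define p where "p = int (s ?k) + int a * y"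
    have eq: "int a * K + c i = int d * p"
      using v unfolding y p_def by (simp only: algebra_simps)
    then have "f K = D * K - p" using d Ki by (simp add: f_def)
    then have "(of_int (f K) :: rat) = of_int D * of_int K - of_int p" by simp
    moreover have "of_nat a * of_int K + of_int (c i) = of_nat d * (of_int p :: rat)"
      using arg_cong[OF eq, of "of_int :: int \<Rightarrow> rat"] by simp
    then have "of_nat a / of_nat d * of_int K + of_int (c i) / of_nat d = (of_int p :: rat)"
      using d by (simp add: field_simps)
    ultimately show ?thesis by (simp add: algebra_simps)
  qed
  have "quasi_linear f"
    unfolding quasi_linear_def using d f
    by (intro exI[of _ d] conjI exI[of _ "\<lambda>_. of_int D - of_nat a / of_nat d"]
        exI[of _ "\<lambda>i. - of_int (c i) / of_nat d"]) auto
  moreover have "f (int k) = D * int k - int (s k)" if "k \<ge> Suc M * d" for k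
  proof -
    have "nat (int k mod int d) = k mod d" by (simp add: nat_mod_distrib)
    then show ?thesis using eventual[OF that] d by (simp add: f_def flip: eventual[OF that])
  qed
  ultimately show ?thesis by blast
qed

section \<open>Saturations of the powers\<close>

lemma exp_power_1:
  assumes "upclosed E"
  shows "exp_power E 1 = E"
proof (intro equalityI subsetI)
  fix m assume "m \<in> E"
  then have "\<exists>a b. m = a + b \<and> a \<in> E" by (intro exI[of _ m] exI[of _ 0]) simp
  then show "m \<in> exp_power E 1" by simp
qed (use assms in \<open>auto simp: upclosed_def\<close>)

locale equigenerated =
  fixes E :: "('n::finite \<Rightarrow>\<^sub>0 nat) set" and e :: nat
  assumes up: "upclosed E" and nonempty: "E \<noteq> {}"
    and generated: "m \<in> E \<Longrightarrow> \<exists>g\<in>E. mdegree g = e \<and> (\<exists>v. m = g + v)"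
begin

section \<open>Powers described by multiplicities of generators\<close>

definition gens :: "('n \<Rightarrow>\<^sub>0 nat) set" where
  "gens = {g \<in> E. mdegree g = e}"

text \<open>With \<open>c\<close> as multiplicities of a product of generators, the weight
  \<open>\<lambda>_. 1\<close> counts its factors and the weight
  \<open>\<lambda>g. lookup g j\<close> gives its exponent at \<open>j\<close>.\<close>

definition total :: "(('n \<Rightarrow>\<^sub>0 nat) \<Rightarrow> nat) \<Rightarrow> (('n \<Rightarrow>\<^sub>0 nat) \<Rightarrow> nat) \<Rightarrow> nat" where
  "total c l = (\<Sum>g\<in>gens. c g * l g)"

lemma finite_gens: "finite gens"
proof -
  have "lookup ` gens \<subseteq> {f. \<forall>i. (i \<in> UNIV \<longrightarrow> f i \<in> {..e}) \<and> (i \<notin> UNIV \<longrightarrow> f i = 0)}"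
    using lookup_le_mdegree by (auto simp: gens_def)
  moreover have "finite {f :: 'n \<Rightarrow> nat. \<forall>i. (i \<in> UNIV \<longrightarrow> f i \<in> {..e}) \<and> (i \<notin> UNIV \<longrightarrow> f i = 0)}"
    by (rule finite_set_of_finite_funs) auto
  ultimately have "finite (lookup ` gens)" by (rule finite_subset)
  moreover have "inj_on lookup gens" by (auto intro!: inj_onI poly_mapping_eqI)
  ultimately show ?thesis by (rule finite_imageD)
qed

lemma total_upd: "g \<in> gens \<Longrightarrow> total (c(g := Suc (c g))) l = total c l + l g"
  unfolding total_def using finite_gens by (simp add: sum.remove[of gens g])

lemma total_add: "total (\<lambda>g. c g + c' g) l = total c l + total c' l"
  by (simp add: total_def algebra_simps sum.distrib)

text \<open>Membership in a power means divisibility by a product of \<open>k\<close> generators.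
  This form is linear in \<open>m\<close>, \<open>k\<close> and \<open>c\<close> jointly, which is
  where the rational cone comes from.\<close>

lemma exp_power_iff:
  "m \<in> exp_power E k \<longleftrightarrow> (\<exists>c. total c (\<lambda>_. 1) = k \<and> (\<forall>j. total c (\<lambda>g. lookup g j) \<le> lookup m j))"
proof (induction k arbitrary: m)
  case 0
  show ?case by (auto simp: total_def intro!: exI[of _ "\<lambda>_. 0"])
next
  case (Suc k)
  show ?case
  proof
    assume "m \<in> exp_power E (Suc k)"
    then obtain a b where ab: "m = a + b" "a \<in> E" "b \<in> exp_power E k" by auto
    then obtain g v where g: "g \<in> gens" "a = g + v" using generated by (fastforce simp: gens_def)
    obtain c where c: "total c (\<lambda>_. 1) = k" "\<And>j. total c (\<lambda>g. lookup g j) \<le> lookup b j"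
      using Suc.IH ab(3) by blast
    show "\<exists>c. total c (\<lambda>_. 1) = Suc k \<and> (\<forall>j. total c (\<lambda>g. lookup g j) \<le> lookup m j)"
    proof (intro exI conjI allI)
      show "total (c(g := Suc (c g))) (\<lambda>_. 1) = Suc k" using c total_upd[OF g(1)] by simp
      show "total (c(g := Suc (c g))) (\<lambda>g. lookup g j) \<le> lookup m j" for j
        using c(2)[of j] total_upd[OF g(1)] by (simp add: ab g lookup_add)
    qed
  next
    assume "\<exists>c. total c (\<lambda>_. 1) = Suc k \<and> (\<forall>j. total c (\<lambda>g. lookup g j) \<le> lookup m j)"
    then obtain c where c: "total c (\<lambda>_. 1) = Suc k" "\<And>j. total c (\<lambda>g. lookup g j) \<le> lookup m j"
      by blast
    have "\<exists>g\<in>gens. c g \<noteq> 0"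
    proof (rule ccontr)
      assume "\<not> ?thesis"
      then have "total c (\<lambda>_. 1) = 0" by (simp add: total_def)
      then show False using c(1) by simp
    qed
    then obtain g where g: "g \<in> gens" "c g \<noteq> 0" by blast
    define c' where "c' = c(g := c g - 1)"
    have cc': "c = c'(g := Suc (c' g))" using g(2) by (auto simp: c'_def)
    have tot: "total c l = total c' l + l g" for l
      by (subst cc') (rule total_upd[OF g(1)])
    have "lookup g j \<le> lookup m j" for j using c(2)[of j] tot[of "\<lambda>g. lookup g j"] by simp
    then obtain v where v: "m = g + v" using lookup_le_imp_ex_add by blast
    have "total c' (\<lambda>g. lookup g j) \<le> lookup v j" for j
      using c(2)[of j] tot[of "\<lambda>g. lookup g j"] by (simp add: v lookup_add)
    moreover have "total c' (\<lambda>_. 1) = k" using c(1) tot[of "\<lambda>_. 1"] by simp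
    ultimately have "v \<in> exp_power E k" using Suc.IH by blast
    moreover have "g \<in> E" using g by (simp add: gens_def)
    ultimately show "m \<in> exp_power E (Suc k)" using v by auto
  qed
qed

lemma exp_power_degree_ge: "m \<in> exp_power E k \<Longrightarrow> k * e \<le> mdegree m"
proof (induction k arbitrary: m)
  case (Suc k)
  then obtain a b where ab: "m = a + b" "a \<in> E" "b \<in> exp_power E k" by auto
  have "e \<le> mdegree a" using generated[OF ab(2)] by auto
  then show ?case using Suc.IH[OF ab(3)] ab(1) by simp
qed simp

lemma exp_power_degree_attained: "\<exists>m\<in>exp_power E k. mdegree m = k * e"
proof (induction k)
  case 0
  show ?case by (intro bexI[of _ 0]) simp_all
next
  case (Suc k)
  then obtain b where "b \<in> exp_power E k" "mdegree b = k * e" by blast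
  moreover obtain g where "g \<in> E" "mdegree g = e" using nonempty generated by blast
  ultimately show ?case by (intro bexI[of _ "g + b"]) auto
qed

text \<open>
  For a monomial ideal, saturating means inverting one variable at a time and intersecting. The
  vector \<open>c i\<close> is the product of generators that witnesses membership after inverting \<open>x\<^sub>i\<close>.
\<close>

definition witness :: "('n \<Rightarrow>\<^sub>0 nat) \<Rightarrow> nat \<Rightarrow> ('n \<Rightarrow> ('n \<Rightarrow>\<^sub>0 nat) \<Rightarrow> nat) \<Rightarrow> bool" where
  "witness u k c \<longleftrightarrow> (\<forall>i. total (c i) (\<lambda>_. 1) = k \<and>
     (\<forall>j. j \<noteq> i \<longrightarrow> total (c i) (\<lambda>g. lookup g j) \<le> lookup u j))"

lemma saturation_exp_power_iff: "u \<in> saturation (exp_power E k) \<longleftrightarrow> (\<exists>c. witness u k c)"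
proof
  assume "u \<in> saturation (exp_power E k)"
  then obtain N where N: "\<And>v. mdegree v \<ge> N \<Longrightarrow> u + v \<in> exp_power E k"
    by (auto simp: saturation_def)
  have "\<exists>c. total c (\<lambda>_. 1) = k \<and> (\<forall>j. j \<noteq> i \<longrightarrow> total c (\<lambda>g. lookup g j) \<le> lookup u j)" for i
  proof -
    have "u + Poly_Mapping.single i N \<in> exp_power E k" by (rule N) simp
    then obtain c where "total c (\<lambda>_. 1) = k"
        "\<And>j. total c (\<lambda>g. lookup g j) \<le> lookup (u + Poly_Mapping.single i N) j"
      unfolding exp_power_iff by blast
    moreover have "lookup (u + Poly_Mapping.single i N) j = lookup u j" if "j \<noteq> i" for j
      using that by (simp add: lookup_add lookup_single)
    ultimately show ?thesis by metis
  qed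
  then show "\<exists>c. witness u k c" unfolding witness_def by metis
next
  assume "\<exists>c. witness u k c"
  then obtain c where c: "witness u k c" by blast
  \<comment> \<open>Pigeonhole over the variables: a monomial of this degree dominates, at some
    \<open>i\<close>, the exponent of the product \<open>c i\<close> at \<open>i\<close>, the only
    one that \<open>witness\<close> leaves unbounded.\<close>
  define N where "N = Suc (\<Sum>i\<in>UNIV. total (c i) (\<lambda>g. lookup g i))"
  have "u + v \<in> exp_power E k" if v: "mdegree v \<ge> N" for v
  proof -
    have "\<exists>i. total (c i) (\<lambda>g. lookup g i) \<le> lookup v i"
    proof (rule ccontr)
      assume "\<not> ?thesis"
      then have "mdegree v \<le> (\<Sum>i\<in>UNIV. total (c i) (\<lambda>g. lookup g i))"
        unfolding mdegree_def by (intro sum_mono) (auto simp: not_le intro: less_imp_le)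
      then show False using v by (simp add: N_def)
    qed
    then obtain i where i: "total (c i) (\<lambda>g. lookup g i) \<le> lookup v i" by blast
    have "total (c i) (\<lambda>g. lookup g j) \<le> lookup (u + v) j" for j
    proof (cases "j = i")
      case False
      then have "total (c i) (\<lambda>g. lookup g j) \<le> lookup u j" using c by (simp add: witness_def)
      then show ?thesis by (simp add: lookup_add)
    qed (use i in \<open>simp add: lookup_add\<close>)
    then show ?thesis using c unfolding exp_power_iff witness_def by blast
  qed
  then show "u \<in> saturation (exp_power E k)" by (auto simp: saturation_def)
qed

lemma witness_add:
  "witness u k c \<Longrightarrow> witness u' k' c' \<Longrightarrow> witness (u + u') (k + k') (\<lambda>i g. c i g + c' i g)"
  by (simp add: witness_def total_add lookup_add add_mono)

lemma total_diff:
  "(\<And>g. g \<in> gens \<Longrightarrow> c g \<le> c' g) \<Longrightarrow> total (\<lambda>g. c' g - c g) l = total c' l - total c l"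
  unfolding total_def diff_mult_distrib by (intro sum_subtractf_nat mult_right_mono) auto

text \<open>Monotonicity of \<open>u\<close> and \<open>c\<close> alone does not keep the
  inequalities under subtraction; monotonicity of their slacks does.\<close>

lemma witness_diff:
  assumes "witness u k c" "witness (u + v) k' c'" "\<And>i g. g \<in> gens \<Longrightarrow> c i g \<le> c' i g"
    and slack: "\<And>i j. lookup u j - total (c i) (\<lambda>g. lookup g j) \<le>
      lookup (u + v) j - total (c' i) (\<lambda>g. lookup g j)"
  shows "witness v (k' - k) (\<lambda>i g. c' i g - c i g)"
  unfolding witness_def
proof (intro allI conjI impI)
  fix i
  have eq: "total (\<lambda>g. c' i g - c i g) l = total (c' i) l - total (c i) l" for l
    by (rule total_diff) (rule assms(3))
  show "total (\<lambda>g. c' i g - c i g) (\<lambda>_. 1) = k' - k"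
    using assms(1,2) by (simp add: eq witness_def)
  fix j assume "j \<noteq> i"
  then have "total (c i) (\<lambda>g. lookup g j) \<le> lookup u j"
      "total (c' i) (\<lambda>g. lookup g j) \<le> lookup (u + v) j"
    using assms(1,2) by (auto simp: witness_def)
  then show "total (\<lambda>g. c' i g - c i g) (\<lambda>g. lookup g j) \<le> lookup v j"
    unfolding eq using slack[of j i] by (simp add: lookup_add)
qed

lemma min_degree_ratio:
  "\<exists>u d. d \<ge> 1 \<and> u \<in> saturation (exp_power E d) \<and>
    (\<forall>k. \<forall>v\<in>saturation (exp_power E k). mdegree u * k \<le> mdegree v * d)"
proof -
  define T where "T = {(u, k, c). witness u k c}"
  define L where "L = (\<lambda>(u :: 'n \<Rightarrow>\<^sub>0 nat, k :: nat, c :: 'n \<Rightarrow> ('n \<Rightarrow>\<^sub>0 nat) \<Rightarrow> nat). mdegree u)"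
  define K where "K = (\<lambda>(u :: 'n \<Rightarrow>\<^sub>0 nat, k :: nat, c :: 'n \<Rightarrow> ('n \<Rightarrow>\<^sub>0 nat) \<Rightarrow> nat). k)"
  \<comment> \<open>The coordinates of the cone: the power, the exponents, the multiplicities and
    the slacks. Comparing multiplicities on \<open>gens\<close> only keeps the family finite;
    including \<open>K\<close> makes \<open>k' - k\<close> a genuine difference.\<close>
  define \<Phi> where "\<Phi> = insert K (range (\<lambda>j (u, k, c). lookup u j) \<union>
      (\<lambda>(i, g) (u, k, c). c i g) ` (UNIV \<times> gens) \<union>
      range (\<lambda>(i, j) (u, k, c). lookup u j - total (c i) (\<lambda>g. lookup g j)))"
  have "\<exists>z\<in>T. K z > 0 \<and> (\<forall>w\<in>T. L z * K w \<le> L w * K z)"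
  proof (rule min_ratio_attained)
    show "finite \<Phi>" unfolding \<Phi>_def using finite_gens by simp
    obtain u where "u \<in> E" using nonempty by blast
    then have "u \<in> saturation (exp_power E 1)"
      unfolding exp_power_1[OF up] using subset_saturation[OF up] by blast
    then obtain c where "witness u 1 c" unfolding saturation_exp_power_iff by blast
    then show "\<exists>z\<in>T. K z > 0" by (intro bexI[of _ "(u, 1, c)"]) (auto simp: T_def K_def)
    fix z z' assume z: "z \<in> T" "z' \<in> T" and le: "\<And>\<phi>. \<phi> \<in> \<Phi> \<Longrightarrow> \<phi> z \<le> \<phi> z'"
    obtain u k c where zc: "z = (u, k, c)" "witness u k c" using z(1) by (auto simp: T_def)
    obtain u' k' c' where zc': "z' = (u', k', c')" "witness u' k' c'" using z(2) by (auto simp: T_def)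
    have "K z \<le> K z'" by (rule le) (simp add: \<Phi>_def)
    then have k: "k \<le> k'" by (simp add: K_def zc zc')
    have "lookup u j \<le> lookup u' j" for j
      using le[of "\<lambda>(u, k, c). lookup u j"] by (simp add: \<Phi>_def zc zc')
    then obtain v where v: "u' = u + v" using lookup_le_imp_ex_add by blast
    have "c i g \<le> c' i g" if "g \<in> gens" for i g
      using le[of "(\<lambda>(i, g) (u, k, c). c i g) (i, g)"] that by (force simp: \<Phi>_def zc zc')
    moreover have "lookup u j - total (c i) (\<lambda>g. lookup g j) \<le> lookup (u + v) j - total (c' i) (\<lambda>g. lookup g j)" for i j
      using le[of "(\<lambda>(i, j) (u, k, c). lookup u j - total (c i) (\<lambda>g. lookup g j)) (i, j)"]
      by (force simp: \<Phi>_def zc zc' v)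
    ultimately have "witness v (k' - k) (\<lambda>i g. c' i g - c i g)"
      using zc(2) zc'(2) unfolding v by (intro witness_diff)
    then show "\<exists>w\<in>T. L z' = L z + L w \<and> K z' = K z + K w"
      by (intro bexI[of _ "(v, k' - k, \<lambda>i g. c' i g - c i g)"])
        (use k in \<open>auto simp: T_def L_def K_def zc zc' v\<close>)
  qed
  then obtain z where z: "z \<in> T" "K z > 0" "\<And>w. w \<in> T \<Longrightarrow> L z * K w \<le> L w * K z" by blast
  obtain u d c where "z = (u, d, c)" by (cases z)
  with z have ud: "witness u d c" "d > 0" "\<And>w. w \<in> T \<Longrightarrow> mdegree u * K w \<le> L w * d"
    by (simp_all add: T_def K_def L_def)
  have "mdegree u * k \<le> mdegree v * d" if v: "v \<in> saturation (exp_power E k)" for v k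
  proof -
    obtain c' where "witness v k c'" using v unfolding saturation_exp_power_iff by blast
    then have "(v, k, c') \<in> T" by (simp add: T_def)
    from ud(3)[OF this] show ?thesis by (simp add: K_def L_def)
  qed
  moreover have "u \<in> saturation (exp_power E d)" using ud(1) saturation_exp_power_iff by blast
  ultimately show ?thesis using ud(2) by (intro exI[of _ u] exI[of _ d]) simp
qed

section \<open>Initial degrees of the saturations and the saturation numbers of the powers\<close>

lemma saturation_exp_power_add:
  assumes "u \<in> saturation (exp_power E k)" "v \<in> saturation (exp_power E l)"
  shows "u + v \<in> saturation (exp_power E (k + l))"
  using assms witness_add unfolding saturation_exp_power_iff by blast

definition initial_degree :: "nat \<Rightarrow> nat" where
  "initial_degree k = (LEAST t. \<exists>u\<in>saturation (exp_power E k). mdegree u = t)"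

lemma initial_degree_attained: "\<exists>u\<in>saturation (exp_power E k). mdegree u = initial_degree k"
proof -
  obtain m where "m \<in> exp_power E k" using exp_power_degree_attained by blast
  then have "\<exists>t. \<exists>u\<in>saturation (exp_power E k). mdegree u = t"
    using subset_saturation upclosed_exp_power up by blast
  then show ?thesis unfolding initial_degree_def by (rule LeastI_ex)
qed

lemma initial_degree_le: "u \<in> saturation (exp_power E k) \<Longrightarrow> initial_degree k \<le> mdegree u"
  unfolding initial_degree_def by (rule Least_le) blast

lemma initial_degree_quasi_linear:
  "\<exists>f. quasi_linear f \<and> (\<exists>k\<^sub>0::nat. \<forall>k\<ge>k\<^sub>0. f (int k) = D * int k - int (initial_degree k))"
proof -
  obtain u d where ud: "d \<ge> 1" "u \<in> saturation (exp_power E d)"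
      "\<And>k v. v \<in> saturation (exp_power E k) \<Longrightarrow> mdegree u * k \<le> mdegree v * d"
    using min_degree_ratio by blast
  show ?thesis
  proof (rule quasi_linear_of_step[OF ud(1), of _ "mdegree u"])
    fix k
    obtain v where v: "v \<in> saturation (exp_power E k)" "mdegree v = initial_degree k"
      using initial_degree_attained by blast
    show "initial_degree (k + d) \<le> initial_degree k + mdegree u"
      using initial_degree_le[OF saturation_exp_power_add[OF v(1) ud(2)]] v(2) by simp
    show "mdegree u * k \<le> d * initial_degree k"
      using ud(3)[OF v(1)] v(2) by (simp add: mult.commute)
  qed
qed

text \<open>Bridge from the resolution to exponents. The second conclusion ensures that the
  subtraction in the first is not truncated, so that it survives the passage to integers.\<close>

lemma sat_exp_power:
  assumes "has_linear_resolution (mon_ideal (exp_power E k) :: ('n, 'k::field) mpoly set)"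
  shows "sat (mon_ideal (exp_power E k) :: ('n, 'k) mpoly set) = k * e - initial_degree k"
    and "initial_degree k \<le> k * e"
proof -
  let ?I = "mon_ideal (exp_power E k) :: ('n, 'k) mpoly set"
  obtain e' where e': "linear_resolution e' ?I" using assms by (auto simp: has_linear_resolution_def)
  have up_k: "upclosed (exp_power E k)" using up by (rule upclosed_exp_power)
  obtain m where m: "m \<in> exp_power E k" "mdegree m = k * e" using exp_power_degree_attained by blast
  have gen: "\<exists>g\<in>exp_power E k. mdegree g = e' \<and> (\<exists>v. m = g + v)" if "m \<in> exp_power E k" for m
    using mon_ideal_generated_in_degree[OF up_k _ that] e' by (auto simp: linear_resolution_def)
  \<comment> \<open>The hypothesis supplies some degree \<open>e'\<close>. The element
    \<open>m\<close> of least degree \<open>k * e\<close> is a multiple of a generator of degree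
    \<open>e'\<close>, which itself has degree at least \<open>k * e\<close>.\<close>
  have "e' = k * e"
    using gen[OF m(1)] m(2) exp_power_degree_ge by (metis add_leD1 antisym_conv mdegree_add order_refl)
  interpret lin: linear_exponents "exp_power E k" "k * e"
  proof
    fix m :: "'n \<Rightarrow>\<^sub>0 nat" assume m: "k * e \<le> mdegree m" "\<And>i. Poly_Mapping.single i 1 + m \<in> exp_power E k"
    have "monomial m \<in> ?I"
    proof (rule linear_resolution_socle[OF e'])
      show "var i * monomial m \<in> ?I" for i using m(2) by (simp add: var_def monomial_mult)
      show "monomial m \<in> (mon_ideal {m. e' \<le> mdegree m} :: ('n, 'k) mpoly set)"
        using m(1) \<open>e' = k * e\<close> by simp
    qed
    then show "m \<in> exp_power E k" by simp
  qed (use up_k exp_power_degree_ge in auto)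
  obtain u where u: "u \<in> saturation (exp_power E k)" "mdegree u = initial_degree k"
    using initial_degree_attained by blast
  have "m \<in> saturation (exp_power E k)" using m(1) subset_saturation[OF up_k] by blast
  then show le: "initial_degree k \<le> k * e" using initial_degree_le m(2) by metis
  show "sat ?I = k * e - initial_degree k"
    using lin.sat_eq[OF u(1)] u(2) le initial_degree_le by metis
qed

end

theorem mainTheorem2:
  fixes I :: "('n::finite, 'k::field) mpoly set"
  assumes "monomial_ideal I"
    and "\<And>k::nat. k \<ge> 1 \<Longrightarrow> has_linear_resolution (ideal_power I k)"
  shows "\<exists>f :: int \<Rightarrow> int. quasi_linear f \<and>
           (\<exists>k\<^sub>0::nat. \<forall>k\<ge>k\<^sub>0. f (int k) = int (sat (ideal_power I k)))"
proof -
  obtain E where E: "upclosed E" "I = mon_ideal E" using assms(1) by (rule monomial_idealE)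
  have power: "ideal_power I k = mon_ideal (exp_power E k)" for k
    using E by (simp add: ideal_power_mon_ideal)
  show ?thesis
  proof (cases "E = {}")
    \<comment> \<open>The zero ideal has no initial degree. All its positive powers and their colons
      by powers of the maximal ideal are zero, so the saturation number is 0.\<close>
    case True
    have "sat (ideal_power I k) = 0" if "k \<ge> 1" for k
    proof -
      obtain l where "k = Suc l" using \<open>k \<ge> 1\<close> by (cases k) auto
      then have "exp_power E k = {}" using True by simp
      then have "sat (ideal_power I k) = sat (mon_ideal {} :: ('n, 'k) mpoly set)" using power by simp
      also have "\<dots> = 0"
      proof -
        fix i :: 'n
        have "\<exists>v :: 'n \<Rightarrow>\<^sub>0 nat. t \<le> mdegree v" for t
          by (intro exI[of _ "Poly_Mapping.single i t"]) simp
        then show ?thesis by (subst sat_mon_ideal) (auto simp: upclosed_def)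
      qed
      finally show ?thesis .
    qed
    moreover have "quasi_linear (\<lambda>_. 0)"
      unfolding quasi_linear_def by (intro exI[of _ 1] conjI exI[of _ "\<lambda>_. 0"]) auto
    ultimately show ?thesis by (intro exI[of _ "\<lambda>_. 0"] conjI exI[of _ 1]) auto
  next
    case False
    obtain e where "linear_resolution e (mon_ideal E :: ('n, 'k) mpoly set)"
      using assms(2)[of 1] exp_power_1[OF E(1)] unfolding power has_linear_resolution_def by auto
    then have "ideal_generated_in_degree (int e) (mon_ideal E :: ('n, 'k) mpoly set)"
      by (simp add: linear_resolution_def)
    from mon_ideal_generated_in_degree[OF E(1) this] interpret equigenerated E e
      using E(1) False by unfold_locales auto
    obtain f and k\<^sub>0 :: nat where f: "quasi_linear f"
        "\<And>k. k \<ge> k\<^sub>0 \<Longrightarrow> f (int k) = int e * int k - int (initial_degree k)"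
      using initial_degree_quasi_linear[of "int e"] by blast
    have "f (int k) = int (sat (ideal_power I k))" if "k \<ge> max k\<^sub>0 1" for k
    proof -
      have "has_linear_resolution (mon_ideal (exp_power E k) :: ('n, 'k) mpoly set)"
        using assms(2)[of k] that power by simp
      from sat_exp_power[OF this] show ?thesis
        using f(2)[of k] that by (simp add: power mult.commute)
    qed
    then show ?thesis using f(1) by blast
  qed
qed

end
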